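(* Let $K$ be a field of characteristic $p>0$ and $s\ge1$. For $u\in\mathcal{M}_{n,s}$ let $G_u$ be the ring endomorphism of $\mathcal{D}(P_n)$ with $G_u(a)=a^{p^s}$ for $a\in P_n$ and $G_u(\partial^{[\alpha]})=y_u^{[\alpha]}$ for $\alpha\in\mathbb{N}^n$. Then $u\mapsto G_u$ is a bijection from $\mathcal{M}_{n,s}$ onto $\mathrm{Frob}_s(\mathcal{D}(P_n),\mathcal{D}_n)$, whose inverse is $G\mapsto(u_{ik}(G))$ with $u_{ik}(G)=G(\partial_i^{[p^k]})-\int_i^{*p^s}G(\partial_i^{[p^k-1]})$.
   Context: $P_n=K[x_1,\ldots,x_n]$; $\partial_i^{[k]}=\partial_i^k/k!$ acting on $P_n$ by $\partial_i^{[k]}(x^m)=\binom{m_i}{k}x^{m-ke_i}$; $\partial^{[\alpha]}=\prod_i\partial_i^{[\alpha_i]}$; $\mathcal{D}(P_n)=\bigoplus_\alpha P_n\partial^{[\alpha]}$ is the ring of differential operators and $\mathcal{D}_n=\bigoplus_\alpha K\partial^{[\alpha]}$. $\mathrm{Frob}_s(\mathcal{D}(P_n),\mathcal{D}_n)$ is the set of ring endomorphisms $G$ of $\mathcal{D}(P_n)$ with $G(P_n)\subseteq P_n$, $G(a)=a^{p^s}$ for all $a\in P_n$, and $G(\mathcal{D}_n)\subseteq\mathcal{D}_n$. $\int_i^*:\mathcal{D}_n\to\mathcal{D}_n$ is the $K$-linear map $\partial^{[\alpha]}\mapsto\partial^{[\alpha+e_i]}$, $\int_i^{*p^s}$ its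 $p^s$-th power; $C_s^n=\{\alpha\in\mathbb{N}^n\mid\alpha_i<p^s\}$; $\mathcal{M}_{n,s}$ is the set of matrices $u=(u_{ik})$, $1\le i\le n$, $k\in\mathbb{N}$, with $u_{ik}\in\bigoplus_{0\neq\alpha\in C_s^n}K\partial^{[\alpha]}$. For $u\in\mathcal{M}_{n,s}$: $y_{u,i}^{[0]}=1$, $y_{u,i}^{[1]}=\partial_i^{[p^s]}+u_{i0}$, $y_{u,i}^{[p^k]}=u_{ik}+\int_i^{*p^s}\prod_{l=0}^{k-1}\frac{(y_{u,i}^{[p^l]})^{p-1}}{(p-1)!}$ for $k\ge1$, $y_{u,i}^{[j]}=\prod_k\frac{(y_{u,i}^{[p^k]})^{j_k}}{j_k!}$ for $j=\sum_kj_kp^k$ ($0\le j_k<p$), and $y_u^{[\alpha]}=\prod_iy_{u,i}^{[\alpha_i]}$. *)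

theory Defs
  imports "HOL-Library.Poly_Mapping" "HOL-Library.FuncSet"
begin

(* Monomials in the variables indexed by the finite type 'n are 'n \<Rightarrow>0 nat;
  the polynomial ring P_n = K[x_i | i :: 'n] is ('n \<Rightarrow>0 nat) \<Rightarrow>0 K.
  The ring of differential operators D(P_n) is realised (faithfully) as a ring of
  K-linear operators on P_n, multiplication being composition. *)

type_synonym ('n, 'a) pol = "('n \<Rightarrow>\<^sub>0 nat) \<Rightarrow>\<^sub>0 'a"
type_synonym ('n, 'a) op = "('n, 'a) pol \<Rightarrow> ('n, 'a) pol"

definition dpa :: "('n::finite \<Rightarrow>\<^sub>0 nat) \<Rightarrow> ('n, 'a::field) op" where
  "dpa \<alpha> f = (\<Sum>m\<in>Poly_Mapping.keys f. Poly_Mapping.single (m - \<alpha>)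
       (of_nat (\<Prod>i\<in>UNIV. (Poly_Mapping.lookup m i choose Poly_Mapping.lookup \<alpha> i)) * (Poly_Mapping.lookup f m :: 'a)))"

definition dpi :: "'n::finite \<Rightarrow> nat \<Rightarrow> ('n, 'a::field) op" where
  "dpi i k = dpa (Poly_Mapping.single i k)"

definition mulop :: "('n, 'a::field) pol \<Rightarrow> ('n, 'a) op" where
  "mulop a = (\<lambda>f. a * f)"

definition opadd :: "('n, 'a::field) op \<Rightarrow> ('n, 'a) op \<Rightarrow> ('n, 'a) op" where
  "opadd S T = (\<lambda>f. S f + T f)"

definition opsub :: "('n, 'a::field) op \<Rightarrow> ('n, 'a) op \<Rightarrow> ('n, 'a) op" where
  "opsub S T = (\<lambda>f. S f - T f)"

definition smulop :: "'a::field \<Rightarrow> ('n, 'a) op \<Rightarrow> ('n, 'a) op" where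
  "smulop c T = (\<lambda>f. Poly_Mapping.single 0 c * T f)"

definition dopP :: "(('n::finite \<Rightarrow>\<^sub>0 nat) \<Rightarrow>\<^sub>0 ('n, 'a::field) pol) \<Rightarrow> ('n, 'a) op" where
  "dopP c = (\<lambda>f. \<Sum>\<alpha>\<in>Poly_Mapping.keys c. Poly_Mapping.lookup c \<alpha> * dpa \<alpha> f)"

definition dopK :: "(('n::finite \<Rightarrow>\<^sub>0 nat) \<Rightarrow>\<^sub>0 'a::field) \<Rightarrow> ('n, 'a) op" where
  "dopK c = (\<lambda>f. \<Sum>\<alpha>\<in>Poly_Mapping.keys c. Poly_Mapping.single 0 (Poly_Mapping.lookup c \<alpha>) * dpa \<alpha> f)"

definition DP :: "('n::finite, 'a::field) op set" where
  "DP = range dopP"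

definition Dn :: "('n::finite, 'a::field) op set" where
  "Dn = range dopK"

definition ring_endo :: "(('n::finite, 'a::field) op \<Rightarrow> ('n, 'a) op) \<Rightarrow> bool" where
  "ring_endo G \<longleftrightarrow> G \<in> extensional DP \<and> (\<forall>T\<in>DP. G T \<in> DP) \<and> G id = id \<and>
     (\<forall>S\<in>DP. \<forall>T\<in>DP. G (opadd S T) = opadd (G S) (G T)) \<and>
     (\<forall>S\<in>DP. \<forall>T\<in>DP. G (S \<circ> T) = G S \<circ> G T)"

definition Frob :: "nat \<Rightarrow> nat \<Rightarrow> ((('n::finite, 'a::field) op \<Rightarrow> ('n, 'a) op) set)" where
  "Frob p s = {G. ring_endo G \<and> (\<forall>a. G (mulop a) = mulop (a ^ (p ^ s))) \<and> (\<forall>T\<in>Dn. G T \<in> Dn)}"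

definition intc :: "'n \<Rightarrow> (('n \<Rightarrow>\<^sub>0 nat) \<Rightarrow>\<^sub>0 'a::field) \<Rightarrow> ('n \<Rightarrow>\<^sub>0 nat) \<Rightarrow>\<^sub>0 'a" where
  "intc i c = (\<Sum>\<alpha>\<in>Poly_Mapping.keys c. Poly_Mapping.single (\<alpha> + Poly_Mapping.single i 1) (Poly_Mapping.lookup c \<alpha>))"

definition intst :: "'n::finite \<Rightarrow> ('n, 'a::field) op \<Rightarrow> ('n, 'a) op" where
  "intst i T = dopK (intc i (THE c. dopK c = T))"

definition intpow :: "nat \<Rightarrow> nat \<Rightarrow> 'n::finite \<Rightarrow> ('n, 'a::field) op \<Rightarrow> ('n, 'a) op" where
  "intpow p s i = intst i ^^ (p ^ s)"

definition Mset :: "nat \<Rightarrow> nat \<Rightarrow> ('n::finite \<Rightarrow> nat \<Rightarrow> ('n, 'a::field) op) set" where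
  "Mset p s = {u. \<forall>i k. \<exists>c. Poly_Mapping.keys c \<subseteq> {\<alpha>. \<alpha> \<noteq> 0 \<and> (\<forall>j. Poly_Mapping.lookup \<alpha> j < p ^ s)} \<and> u i k = dopK c}"

(* ypq p s u i k = (y_{u,i}^[p^k], prod_{l<k} (y_{u,i}^[p^l])^(p-1)/(p-1)!) *)
fun ypq :: "nat \<Rightarrow> nat \<Rightarrow> ('n::finite \<Rightarrow> nat \<Rightarrow> ('n, 'a::field) op) \<Rightarrow> 'n \<Rightarrow> nat
            \<Rightarrow> ('n, 'a) op \<times> ('n, 'a) op" where
  "ypq p s u i 0 = (opadd (dpi i (p ^ s)) (u i 0), id)"
| "ypq p s u i (Suc k) =
     (let (y, q) = ypq p s u i k;
          q' = q \<circ> smulop (inverse (of_nat (fact (p - 1)))) (y ^^ (p - 1))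
      in (opadd (u i (Suc k)) (intpow p s i q'), q'))"

definition ypk :: "nat \<Rightarrow> nat \<Rightarrow> ('n::finite \<Rightarrow> nat \<Rightarrow> ('n, 'a::field) op) \<Rightarrow> 'n \<Rightarrow> nat \<Rightarrow> ('n, 'a) op" where
  "ypk p s u i k = fst (ypq p s u i k)"

(* y_{u,i}^[j] = prod_k (y_{u,i}^[p^k])^(j_k) / j_k!,  j = sum_k j_k p^k (digits beyond j vanish) *)
definition yj :: "nat \<Rightarrow> nat \<Rightarrow> ('n::finite \<Rightarrow> nat \<Rightarrow> ('n, 'a::field) op) \<Rightarrow> 'n \<Rightarrow> nat \<Rightarrow> ('n, 'a) op" where
  "yj p s u i j = fold (\<lambda>k acc. acc \<circ> smulop (inverse (of_nat (fact ((j div p ^ k) mod p))))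
                                  (ypk p s u i k ^^ ((j div p ^ k) mod p))) [0..<Suc j] id"

definition yalpha :: "nat \<Rightarrow> nat \<Rightarrow> ('n::finite \<Rightarrow> nat \<Rightarrow> ('n, 'a::field) op) \<Rightarrow> ('n \<Rightarrow>\<^sub>0 nat) \<Rightarrow> ('n, 'a) op" where
  "yalpha p s u \<alpha> = Finite_Set.fold (\<lambda>i acc. yj p s u i (Poly_Mapping.lookup \<alpha> i) \<circ> acc) id UNIV"

definition Gu_prop :: "nat \<Rightarrow> nat \<Rightarrow> ('n::finite \<Rightarrow> nat \<Rightarrow> ('n, 'a::field) op)
                       \<Rightarrow> (('n, 'a) op \<Rightarrow> ('n, 'a) op) \<Rightarrow> bool" where
  "Gu_prop p s u G \<longleftrightarrow> ring_endo G \<and> (\<forall>a. G (mulop a) = mulop (a ^ (p ^ s)))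
                       \<and> (\<forall>\<alpha>. G (dpa \<alpha>) = yalpha p s u \<alpha>)"

definition Gu :: "nat \<Rightarrow> nat \<Rightarrow> ('n::finite \<Rightarrow> nat \<Rightarrow> ('n, 'a::field) op) \<Rightarrow> ('n, 'a) op \<Rightarrow> ('n, 'a) op" where
  "Gu p s u = (THE G. Gu_prop p s u G)"

definition uG :: "nat \<Rightarrow> nat \<Rightarrow> (('n::finite, 'a::field) op \<Rightarrow> ('n, 'a) op) \<Rightarrow> 'n \<Rightarrow> nat \<Rightarrow> ('n, 'a) op" where
  "uG p s G i k = opsub (G (dpi i (p ^ k))) (intpow p s i (G (dpi i (p ^ k - 1))))"

end

theory Submission
  imports Defs "HOL-Computational_Algebra.Primes"
begin

text \<open>Put \<open>q = p\<^sup>s\<close>. Since \<open>q\<close> is a power of the characteristic, the commutator with \<open>x\<^sub>j\<^bsup>q\<^esup>\<close> is a derivation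
  \<open>\<delta>\<^sub>j\<close> of the commutative ring \<open>\<D>\<^sub>n\<close> with \<open>\<delta>\<^sub>j(\<partial>\<^bsup>[\<alpha>]\<^esup>) = \<partial>\<^bsup>[\<alpha> - q e\<^sub>j]\<^esup>\<close>; the operator \<open>\<integral>\<^sub>j\<^bsup>*q\<^esup>\<close> is a section of it,
  and the common kernel of all \<open>\<delta>\<^sub>j\<close> is spanned by the \<open>\<partial>\<^bsup>[\<alpha>]\<^esup>\<close> with \<open>\<alpha> \<in> C\<^sub>s\<^bsup>n\<^esup>\<close>.
  A family \<open>z\<^sub>\<alpha> \<in> \<D>\<^sub>n\<close> extends the \<open>q\<close>-th power map to a ring endomorphism with \<open>\<partial>\<^bsup>[\<alpha>]\<^esup> \<mapsto> z\<^sub>\<alpha>\<close> iff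
  it satisfies the divided power relations and \<open>\<delta>\<^sub>j z\<^sub>\<alpha> = z\<^bsub>\<alpha> - e\<^sub>j\<^esub>\<close>. The divided power relations hold for the
  \<open>y\<^sub>u\<^bsup>[\<alpha>]\<^esup>\<close> by Lucas' theorem, because \<open>p\<close>-th powers of elements without constant term vanish. Solving
  \<open>\<delta>\<^sub>j z = z'\<close> for the images of the \<open>\<partial>\<^sub>i\<^bsup>[p\<^sup>k]\<^esup>\<close> determines them up to the kernel, and this freedom is \<open>u\<^sub>i\<^sub>k\<close>; its
  constant term is zero since \<open>(\<partial>\<^sub>i\<^bsup>[p\<^sup>k]\<^esup>)\<^sup>p = 0\<close>.\<close>

section \<open>Additive induction on finitely supported maps\<close>

abbreviation lkp :: "('b \<Rightarrow>\<^sub>0 'c::zero) \<Rightarrow> 'b \<Rightarrow> 'c"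
  where "lkp \<equiv> Poly_Mapping.lookup"

abbreviation sgl :: "'b \<Rightarrow> 'c::zero \<Rightarrow> 'b \<Rightarrow>\<^sub>0 'c"
  where "sgl \<equiv> Poly_Mapping.single"

lemma sum_single_keys: "(\<Sum>a\<in>Poly_Mapping.keys f. sgl a (lkp f a)) = f"
  by (rule poly_mapping_eqI)
     (auto simp: lookup_sum lookup_single when_def in_keys_iff sum.delta')

lemma poly_mapping_additive_induct [case_names single add]:
  fixes f :: "'b \<Rightarrow>\<^sub>0 'c::comm_monoid_add"
  assumes "\<And>m c. P (sgl m c)" and "\<And>f g. P f \<Longrightarrow> P g \<Longrightarrow> P (f + g)"
  shows "P f"
proof -
  have "P (\<Sum>a\<in>A. sgl a (lkp f a))" if "finite A" for A
    using that
  proof (induction A rule: finite_induct)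
    case empty
    \<comment> \<open>Zero is itself a monomial with coefficient 0, at any index.\<close>
    show ?case using assms(1)[of undefined 0] by simp
  next
    case (insert a A)
    then show ?case using assms by simp
  qed
  from this[of "Poly_Mapping.keys f"] show ?thesis
    by (simp add: sum_single_keys)
qed

lemma additive_eqI:
  fixes S T :: "('b \<Rightarrow>\<^sub>0 'c::comm_monoid_add) \<Rightarrow> 'd::plus"
  assumes "\<And>f g. S (f + g) = S f + S g" and "\<And>f g. T (f + g) = T f + T g"
    and "\<And>m c. S (sgl m c) = T (sgl m c)"
  shows "S f = T f"
  by (induction f rule: poly_mapping_additive_induct) (auto simp: assms)

text \<open>Makes the freshman's dream available in P_n.\<close>

lemma CHAR_poly_mapping [simp]:
  "CHAR(('b::comm_monoid_add) \<Rightarrow>\<^sub>0 ('c::comm_semiring_1)) = CHAR('c)"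
proof (rule CHAR_eqI)
  show "of_nat CHAR('c) = (0 :: 'b \<Rightarrow>\<^sub>0 'c)"
    by (simp add: of_nat_single)
next
  fix n assume "of_nat n = (0 :: 'b \<Rightarrow>\<^sub>0 'c)"
  then have "lkp (of_nat n :: 'b \<Rightarrow>\<^sub>0 'c) 0 = 0" by simp
  then show "CHAR('c) dvd n"
    by (simp add: lookup_of_nat of_nat_eq_0_iff_char_dvd)
qed

section \<open>Divided power operators on monomials\<close>

definition mchoose :: "('n::finite \<Rightarrow>\<^sub>0 nat) \<Rightarrow> ('n \<Rightarrow>\<^sub>0 nat) \<Rightarrow> nat"
  where "mchoose m a = (\<Prod>i\<in>UNIV. lkp m i choose lkp a i)"

lemma mchoose_0 [simp]: "mchoose m 0 = 1"
  by (simp add: mchoose_def)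

lemma mchoose_eq_0: "lkp m i < lkp a i \<Longrightarrow> mchoose m a = 0"
  unfolding mchoose_def by (rule prod_zero) auto

lemma mchoose_remove:
  "mchoose m a = (lkp m j choose lkp a j) * (\<Prod>i\<in>UNIV - {j}. lkp m i choose lkp a i)"
  unfolding mchoose_def by (rule prod.remove) auto

text \<open>Both sides count the disjoint pairs of a \<open>b\<close>-subset and an
  \<open>a\<close>-subset of an \<open>m\<close>-set; for \<open>a + b > m\<close> both are 0
  despite truncated subtraction.\<close>

lemma choose_mult_choose: "(m choose b) * ((m - b) choose a) = ((a + b) choose a) * (m choose (a + b))"
proof (cases "a + b \<le> m")
  case True
  then show ?thesis
    using choose_mult[of b "a + b" m] binomial_symmetric[of b "a + b"]
    by (simp add: algebra_simps)
next
  case False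
  then show ?thesis by (cases "b \<le> m") (auto simp: binomial_eq_0)
qed

lemma mchoose_mult_mchoose: "mchoose m b * mchoose (m - b) a = mchoose (a + b) a * mchoose m (a + b)"
  by (simp add: mchoose_def lookup_add lookup_minus choose_mult_choose flip: prod.distrib)

lemma dpa_single: "dpa a (sgl m c) = sgl (m - a) (of_nat (mchoose m a) * c)"
  by (auto simp: dpa_def mchoose_def)

lemma dpa_add: "dpa a (f + g) = dpa a f + dpa a g"
  unfolding dpa_def
  by (rule setsum_keys_plus_distrib) (auto simp: single_add algebra_simps)

lemma dpa_const_mult: "dpa a (sgl 0 c * f) = sgl 0 c * dpa a f"
  by (rule additive_eqI[where S = "\<lambda>f. dpa a (sgl 0 c * f)" and T = "\<lambda>f. sgl 0 c * dpa a f"])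
     (auto simp: dpa_add dpa_single algebra_simps mult_single)

lemma dpa_0 [simp]: "dpa 0 f = f"
  by (rule additive_eqI[where S = "dpa 0" and T = "\<lambda>f. f"]) (auto simp: dpa_add dpa_single)

lemma dpa_dpa: "dpa a (dpa b f) = of_nat (mchoose (a + b) a) * dpa (a + b) f"
proof (rule additive_eqI[where S = "\<lambda>f. dpa a (dpa b f)"
      and T = "\<lambda>f. of_nat (mchoose (a + b) a) * dpa (a + b) f"])
  fix m c
  have "of_nat (mchoose (m - b) a) * (of_nat (mchoose m b) * c) =
        of_nat (mchoose (a + b) a) * (of_nat (mchoose m (a + b)) * (c::'b))"
    using arg_cong[OF mchoose_mult_mchoose[of m b a], of "of_nat :: nat \<Rightarrow> 'b"]
    by (simp add: mult_ac)
  note this[simp]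
  show "dpa a (dpa b (sgl m c)) = of_nat (mchoose (a + b) a) * dpa (a + b) (sgl m c)"
    by (simp add: dpa_single of_nat_single mult_single diff_diff_add add.commute del: single_of_nat)
qed (auto simp: dpa_add algebra_simps)

text \<open>The coefficientwise form of \<open>(1 + X)\<^sup>n = 1 + X\<^sup>n\<close> over \<^typ>\<open>'a\<close>, multiplied by \<open>(1 + X)\<^sup>m\<close>.\<close>

definition additive_exponent :: "'a::field itself \<Rightarrow> nat \<Rightarrow> bool" where
  "additive_exponent _ n \<longleftrightarrow> (\<forall>m a. (of_nat ((m + n) choose a) :: 'a) =
     of_nat (m choose a) + (if n \<le> a then of_nat (m choose (a - n)) else 0))"

lemma additive_exponent_1: "additive_exponent TYPE('a::field) 1"
  unfolding additive_exponent_def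
proof (intro allI)
  fix m a
  show "(of_nat ((m + 1) choose a) :: 'a) =
     of_nat (m choose a) + (if 1 \<le> a then of_nat (m choose (a - 1)) else 0)"
    by (cases a) auto
qed

text \<open>Only the j-th factor of \<open>mchoose\<close> changes under multiplication by x_j^n, so
  the additivity of the exponent yields the commutator. Used with \<open>n = 1\<close> (Leibniz
  rule) and with n a power of the characteristic.\<close>

lemma dpa_X_mult:
  fixes f :: "('n::finite, 'a::field) pol"
  assumes "additive_exponent TYPE('a) n"
  shows "dpa a (sgl (sgl j n) 1 * f) =
    sgl (sgl j n) 1 * dpa a f + (if n \<le> lkp a j then dpa (a - sgl j n) f else 0)"
proof (rule additive_eqI[where S = "\<lambda>f. dpa a (sgl (sgl j n) 1 * f)"])
  fix m c
  let ?C = "\<lambda>m a. of_nat (mchoose m a) :: 'a"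
  \<comment> \<open>Truncated subtraction breaks this rearrangement of exponents only where the
    coefficient is 0.\<close>
  have 1: "sgl (sgl j n + m - a) (?C m a * c) = sgl (sgl j n + (m - a)) (?C m a * c)"
  proof (cases "lkp a j \<le> lkp m j")
    case True
    have "sgl j n + m - a = sgl j n + (m - a)"
      by (rule poly_mapping_eqI) (use True in \<open>auto simp: lookup_add lookup_minus lookup_single when_def\<close>)
    then show ?thesis by simp
  next
    case False
    then have "mchoose m a = 0" by (intro mchoose_eq_0[of _ j]) auto
    then show ?thesis by simp
  qed
  have 2: "sgl (sgl j n + m - a) (?C m (a - sgl j n) * c) = sgl (m - (a - sgl j n)) (?C m (a - sgl j n) * c)"
    if "n \<le> lkp a j"
  proof -
    have "sgl j n + m - a = m - (a - sgl j n)"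
      by (rule poly_mapping_eqI) (use that in \<open>auto simp: lookup_add lookup_minus lookup_single when_def\<close>)
    then show ?thesis by simp
  qed
  have 3: "?C (sgl j n + m) a = ?C m a + (if n \<le> lkp a j then ?C m (a - sgl j n) else 0)"
  proof -
    have A: "of_nat ((lkp m j + n) choose lkp a j) =
      (of_nat (lkp m j choose lkp a j) + (if n \<le> lkp a j then of_nat (lkp m j choose (lkp a j - n)) else 0) :: 'a)"
      using assms by (auto simp: additive_exponent_def)
    have B: "(\<Prod>i\<in>UNIV - {j}. lkp (sgl j n + m) i choose lkp a i) = (\<Prod>i\<in>UNIV - {j}. lkp m i choose lkp a i)"
      by (rule prod.cong) (auto simp: lookup_add lookup_single)
    have C: "(\<Prod>i\<in>UNIV - {j}. lkp m i choose lkp (a - sgl j n) i) = (\<Prod>i\<in>UNIV - {j}. lkp m i choose lkp a i)"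
      by (rule prod.cong) (auto simp: lookup_minus lookup_single)
    show ?thesis
      unfolding mchoose_remove[of _ _ j] B C of_nat_mult
      using A by (auto simp: lookup_add lookup_minus add.commute algebra_simps)
  qed
  show "dpa a (sgl (sgl j n) 1 * sgl m c) =
    sgl (sgl j n) 1 * dpa a (sgl m c) + (if n \<le> lkp a j then dpa (a - sgl j n) (sgl m c) else 0)"
    using 1 2 by (auto simp: mult_single dpa_single 3 distrib_right single_add)
qed (auto simp: dpa_add algebra_simps)

section \<open>Operators with constant coefficients form a commutative ring\<close>

lemma dopK_add: "dopK (c + d) = opadd (dopK c) (dopK d)"
  unfolding dopK_def opadd_def
  by (rule ext, rule setsum_keys_plus_distrib) (auto simp: single_add algebra_simps)

lemma dopK_single: "dopK (sgl a c) = smulop c (dpa a)"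
  by (auto simp: dopK_def smulop_def)

lemma dopK_arg_add: "dopK c (f + g) = dopK c f + dopK c g"
  by (simp add: dopK_def dpa_add distrib_left sum.distrib)

lemma dopK_const_mult: "dopK c (sgl 0 k * f) = sgl 0 k * dopK c f"
  by (simp add: dopK_def dpa_const_mult sum_distrib_left mult.left_commute)

lemma smulop_dpa_in_Dn: "smulop c (dpa a) \<in> Dn"
  unfolding Dn_def dopK_single[symmetric] by simp

lemma dpa_in_Dn: "dpa a \<in> Dn"
  using smulop_dpa_in_Dn[of 1 a] by (simp add: smulop_def)

lemma opadd_in_Dn: "S \<in> Dn \<Longrightarrow> T \<in> Dn \<Longrightarrow> opadd S T \<in> Dn"
  unfolding Dn_def by (auto simp flip: dopK_add)

lemma Dn_induct [consumes 1, case_names single add]: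
  assumes "T \<in> Dn" and "\<And>a c. P (smulop c (dpa a))"
    and "\<And>S T. S \<in> Dn \<Longrightarrow> T \<in> Dn \<Longrightarrow> P S \<Longrightarrow> P T \<Longrightarrow> P (opadd S T)"
  shows "P T"
proof -
  have "P (dopK c)" for c
    by (induction c rule: poly_mapping_additive_induct)
       (auto simp: dopK_single dopK_add assms Dn_def)
  then show ?thesis using assms(1) by (auto simp: Dn_def)
qed

lemma Dn_arg_add: "T \<in> Dn \<Longrightarrow> T (f + g) = T f + T g"
  by (auto simp: Dn_def dopK_arg_add)

lemma Dn_const_mult: "T \<in> Dn \<Longrightarrow> T (sgl 0 k * f) = sgl 0 k * T f"
  by (auto simp: Dn_def dopK_const_mult)

lemma smulop_dpa_comp:
  "smulop c (dpa a) \<circ> smulop d (dpa b) = smulop (c * d * of_nat (mchoose (a + b) a)) (dpa (a + b))"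
proof
  fix f :: "('a, 'b) pol"
  have "sgl 0 (c * d * of_nat (mchoose (a + b) a)) =
    sgl 0 c * sgl 0 d * (of_nat (mchoose (a + b) a) :: ('a, 'b) pol)"
    by (simp add: of_nat_single mult_single del: single_of_nat)
  then show "(smulop c (dpa a) \<circ> smulop d (dpa b)) f =
      smulop (c * d * of_nat (mchoose (a + b) a)) (dpa (a + b)) f"
    by (simp add: smulop_def dpa_const_mult dpa_dpa mult.assoc)
qed

lemma mchoose_symmetric: "mchoose (a + b) a = mchoose (a + b) b"
  unfolding mchoose_def
proof (rule prod.cong)
  fix i
  show "lkp (a + b) i choose lkp a i = lkp (a + b) i choose lkp b i"
    using binomial_symmetric[of "lkp a i" "lkp a i + lkp b i"] by (simp add: lookup_add)
qed simp

lemma Dn_comp: assumes "S \<in> Dn" "T \<in> Dn" shows "S \<circ> T \<in> Dn"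
  using assms(1)
proof (induction rule: Dn_induct)
  case (single a c)
  from assms(2) show ?case
  proof (induction rule: Dn_induct)
    case (single b d)
    show ?case by (simp add: smulop_dpa_comp smulop_dpa_in_Dn)
  next
    case (add S T)
    have "smulop c (dpa a) \<circ> opadd S T = opadd (smulop c (dpa a) \<circ> S) (smulop c (dpa a) \<circ> T)"
      by (auto simp: opadd_def smulop_def dpa_add distrib_left)
    then show ?case using opadd_in_Dn[OF add(3,4)] by (simp add: comp_def)
  qed
next
  case (add S1 S2)
  have "opadd S1 S2 \<circ> T = opadd (S1 \<circ> T) (S2 \<circ> T)"
    by (auto simp: opadd_def)
  then show ?case using opadd_in_Dn[OF add(3,4)] by (simp add: comp_def)
qed

lemma Dn_commute: assumes "S \<in> Dn" "T \<in> Dn" shows "S (T f) = T (S f)"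
  using assms(1)
proof (induction rule: Dn_induct)
  case (single a c)
  from assms(2) show ?case
  proof (induction rule: Dn_induct)
    case (single b d)
    show ?case
      using fun_cong[OF smulop_dpa_comp[of c a d b], of f] fun_cong[OF smulop_dpa_comp[of d b c a], of f]
      by (simp add: add.commute mult.commute mult.left_commute mchoose_symmetric[of a b])
  next
    case (add S T)
    then show ?case by (auto simp: opadd_def smulop_def dpa_add distrib_left)
  qed
next
  case (add S1 S2)
  then show ?case using Dn_arg_add[OF assms(2)] by (simp add: opadd_def)
qed

lemma zero_in_Dn: "(\<lambda>f. 0) \<in> Dn"
  using smulop_dpa_in_Dn[of 0 0] by (simp add: smulop_def)

lemma id_in_Dn: "(id :: ('n::finite, 'a::field) op) \<in> Dn"
proof -
  have "dpa 0 = (id :: ('n::finite, 'a::field) op)" by (rule ext) simp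
  then show ?thesis using dpa_in_Dn by metis
qed

lemma smulop_in_Dn: assumes "T \<in> Dn" shows "smulop c T \<in> Dn"
proof -
  have "smulop c T = smulop c (dpa 0) \<circ> T" by (auto simp: smulop_def)
  then show ?thesis using Dn_comp[OF smulop_dpa_in_Dn assms] by simp
qed

lemma uminus_in_Dn: assumes "T \<in> Dn" shows "(\<lambda>f. - T f) \<in> Dn"
proof -
  have "(\<lambda>f. - T f) = smulop (-1) T" by (auto simp: smulop_def single_uminus)
  then show ?thesis using smulop_in_Dn[OF assms] by simp
qed

lemma opsub_in_Dn: assumes "S \<in> Dn" "T \<in> Dn" shows "opsub S T \<in> Dn"
proof -
  have "opsub S T = opadd S (\<lambda>f. - T f)" by (auto simp: opadd_def opsub_def)
  then show ?thesis using assms by (simp add: opadd_in_Dn uminus_in_Dn)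
qed

text \<open>\<open>\<D>\<^sub>n\<close> as a type, so that the commutative ring library applies to it.\<close>

typedef (overloaded) ('n, 'a) dn = "Dn :: ('n::finite, 'a::field) op set"
  using id_in_Dn by blast

lemmas Rep_dn_in [simp] = Rep_dn
lemmas Rep_dn_add_arg = Dn_arg_add[OF Rep_dn]

lemma dn_eqI: "(\<And>f. Rep_dn x f = Rep_dn y f) \<Longrightarrow> x = y"
  by (metis Rep_dn_inject ext)

instantiation dn :: (finite, field) comm_ring_1
begin

definition "0 = Abs_dn (\<lambda>f. 0)"
definition "1 = Abs_dn id"
definition "x + y = Abs_dn (opadd (Rep_dn x) (Rep_dn y))"
definition "- x = Abs_dn (\<lambda>f. - Rep_dn x f)"
definition "x - y = Abs_dn (opsub (Rep_dn x) (Rep_dn y))"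
definition "x * y = Abs_dn (Rep_dn x \<circ> Rep_dn y)"

lemma Rep_dn_zero: "Rep_dn 0 = (\<lambda>f. 0)"
  by (simp add: zero_dn_def Abs_dn_inverse zero_in_Dn)
lemma Rep_dn_one: "Rep_dn 1 = id"
  by (simp add: one_dn_def Abs_dn_inverse id_in_Dn)
lemma Rep_dn_plus: "Rep_dn (x + y) = opadd (Rep_dn x) (Rep_dn y)"
  by (simp add: plus_dn_def Abs_dn_inverse opadd_in_Dn)
lemma Rep_dn_uminus: "Rep_dn (- x) = (\<lambda>f. - Rep_dn x f)"
  by (simp add: uminus_dn_def Abs_dn_inverse uminus_in_Dn)
lemma Rep_dn_minus: "Rep_dn (x - y) = opsub (Rep_dn x) (Rep_dn y)"
  by (simp add: minus_dn_def Abs_dn_inverse opsub_in_Dn)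
lemma Rep_dn_times: "Rep_dn (x * y) = Rep_dn x \<circ> Rep_dn y"
  by (simp add: times_dn_def Abs_dn_inverse Dn_comp)

lemmas Rep_dn_ring = Rep_dn_zero Rep_dn_one Rep_dn_plus Rep_dn_uminus Rep_dn_minus Rep_dn_times

instance
proof
  show "(0::('a, 'b) dn) \<noteq> 1"
  proof
    assume "(0::('a, 'b) dn) = 1"
    then have "Rep_dn (0::('a, 'b) dn) 1 = Rep_dn 1 1" by simp
    then show False by (simp add: Rep_dn_ring)
  qed
qed (auto intro!: dn_eqI simp: Rep_dn_ring opadd_def opsub_def Rep_dn_add_arg Dn_commute)

end

subsection \<open>Coefficients and powers in the divided power algebra\<close>

definition dn_of :: "(('n::finite \<Rightarrow>\<^sub>0 nat) \<Rightarrow>\<^sub>0 'a::field) \<Rightarrow> ('n, 'a) dn"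
  where "dn_of c = Abs_dn (dopK c)"

definition dn_const :: "'a::field \<Rightarrow> ('n::finite, 'a) dn"
  where "dn_const c = dn_of (sgl 0 c)"

definition dn_basis :: "('n::finite \<Rightarrow>\<^sub>0 nat) \<Rightarrow> ('n, 'a::field) dn"
  where "dn_basis a = dn_of (sgl a 1)"

text \<open>Applied to x^a, \<open>dpa b\<close> leaves a constant term only for
  \<open>b = a\<close>, where it is 1; so this reads off the coefficient of
  \<open>dn_basis a\<close>.\<close>

definition coef :: "('n::finite, 'a::field) dn \<Rightarrow> ('n \<Rightarrow>\<^sub>0 nat) \<Rightarrow> 'a"
  where "coef x a = lkp (Rep_dn x (sgl a 1)) 0"

lemma Rep_dn_of: "Rep_dn (dn_of c) = dopK c"
  by (simp add: dn_of_def Abs_dn_inverse Dn_def)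

lemma Rep_dn_basis: "Rep_dn (dn_basis a) = dpa a"
  by (auto simp: dn_basis_def Rep_dn_of dopK_single smulop_def)

lemma Rep_dn_const: "Rep_dn (dn_const c) f = sgl 0 c * f"
  by (simp add: dn_const_def Rep_dn_of dopK_single smulop_def)

lemma Rep_dn_const_mult: "Rep_dn (dn_const c * x) = smulop c (Rep_dn x)"
  by (auto simp: Rep_dn_times Rep_dn_const smulop_def)

lemma dn_of_add: "dn_of (c + d) = dn_of c + dn_of d"
  by (rule dn_eqI) (simp add: Rep_dn_of Rep_dn_plus dopK_add)

lemma dn_of_single: "dn_of (sgl a c) = dn_const c * dn_basis a"
  by (rule dn_eqI) (simp add: Rep_dn_of Rep_dn_const_mult Rep_dn_basis dopK_single)

lemma dn_of_surj: "\<exists>c. x = dn_of c"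
proof -
  have "Rep_dn x \<in> range dopK" using Rep_dn[of x] by (simp add: Dn_def)
  then obtain c where "Rep_dn x = dopK c" by blast
  then have "x = dn_of c" by (intro dn_eqI) (simp add: Rep_dn_of)
  then show ?thesis by blast
qed

lemma dn_induct [case_names single add]:
  assumes "\<And>a c. P (dn_const c * dn_basis a)" and "\<And>x y. P x \<Longrightarrow> P y \<Longrightarrow> P (x + y)"
  shows "P (x :: ('n::finite, 'a::field) dn)"
proof -
  obtain c where "x = dn_of c" using dn_of_surj by blast
  moreover have "P (dn_of c)"
    by (induction c rule: poly_mapping_additive_induct) (auto simp: dn_of_add dn_of_single assms)
  ultimately show ?thesis by simp
qed

lemma coef_0 [simp]: "coef 0 a = 0"
  by (simp add: coef_def Rep_dn_ring)

lemma coef_add: "coef (x + y) a = coef x a + coef y a"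
  by (simp add: coef_def Rep_dn_ring opadd_def lookup_add)

lemma coef_minus: "coef (x - y) a = coef x a - coef y a"
  by (simp add: coef_def Rep_dn_ring opsub_def lookup_minus)

lemma lookup_const_mult: "lkp (sgl 0 c * f) m = c * lkp f m"
  by (induction f rule: poly_mapping_additive_induct)
     (auto simp: mult_single lookup_single when_def distrib_left lookup_add)

lemma coef_dn_const_mult: "coef (dn_const c * x) a = c * coef x a"
  by (simp add: coef_def Rep_dn_const_mult smulop_def lookup_const_mult)

lemma coef_dn_basis: "coef (dn_basis b) a = (if a = b then 1 else 0)"
proof (cases "\<forall>i. lkp b i \<le> lkp a i")
  case True
  then have "a - b = 0 \<longleftrightarrow> a = b"
    by (auto simp: poly_mapping_eq_iff fun_eq_iff lookup_minus intro: antisym)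
  moreover have "mchoose b b = 1" by (simp add: mchoose_def)
  ultimately show ?thesis
    by (auto simp: coef_def Rep_dn_basis dpa_single lookup_single when_def)
next
  case False
  then obtain i where "lkp a i < lkp b i" by (auto simp: not_le)
  then have "mchoose a b = 0" "a \<noteq> b" by (auto intro: mchoose_eq_0)
  then show ?thesis by (simp add: coef_def Rep_dn_basis dpa_single)
qed

lemma coef_dn_of: "coef (dn_of c) a = lkp c a"
  by (induction c rule: poly_mapping_additive_induct)
     (auto simp: dn_of_single dn_of_add coef_add lookup_add coef_dn_const_mult coef_dn_basis lookup_single when_def)

lemma dn_eq_coefI: "(\<And>a. coef x a = coef y a) \<Longrightarrow> x = y"
  using dn_of_surj[of x] dn_of_surj[of y] by (metis coef_dn_of poly_mapping_eqI)

text \<open>Coefficients can be read off with \<open>coef\<close>. This uniqueness gives the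
  definite description in \<open>intst\<close> its value.\<close>

lemma dopK_inject: "dopK c = dopK d \<longleftrightarrow> c = d"
proof
  assume "dopK c = dopK d"
  then have "dn_of c = dn_of d" by (simp add: dn_of_def)
  then show "c = d" by (metis coef_dn_of poly_mapping_eqI)
qed simp

lemma dn_basis_0 [simp]: "dn_basis 0 = 1"
  by (rule dn_eqI) (simp add: Rep_dn_basis Rep_dn_one)

lemma dn_const_1 [simp]: "dn_const 1 = 1"
  by (rule dn_eqI) (simp add: Rep_dn_const Rep_dn_one)

lemma dn_const_0 [simp]: "dn_const 0 = 0"
  by (rule dn_eqI) (simp add: Rep_dn_const Rep_dn_zero)

lemma dn_const_add: "dn_const (c + d) = dn_const c + dn_const d"
  by (rule dn_eqI) (simp add: Rep_dn_const Rep_dn_plus opadd_def single_add distrib_right)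

lemma dn_const_mult: "dn_const (c * d) = dn_const c * dn_const d"
  by (rule dn_eqI) (simp add: Rep_dn_const Rep_dn_times mult_single flip: mult.assoc)

lemma dn_const_power: "dn_const (c ^ n) = dn_const c ^ n"
  by (induction n) (auto simp: dn_const_mult)

lemma dn_const_of_nat: "dn_const (of_nat n) = of_nat n"
  by (induction n) (auto simp: dn_const_add)

lemma coef_of_nat_mult: "coef (of_nat n * x) a = of_nat n * coef x a"
  by (metis coef_dn_const_mult dn_const_of_nat)

lemma coef_1: "coef 1 a = (if a = 0 then 1 else 0)"
  using coef_dn_basis[of 0 a] by simp

lemma coef_dn_const: "coef (dn_const c) a = (if a = 0 then c else 0)"
  using coef_dn_const_mult[of c 1 a] by (simp add: coef_1)

lemma dn_basis_mult: "(dn_basis a :: ('n::finite, 'a::field) dn) * dn_basis b = of_nat (mchoose (a + b) a) * dn_basis (a + b)"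
proof (rule dn_eqI)
  fix f
  have "Rep_dn (of_nat n) g = of_nat n * g" for n and g :: "('n, 'a) pol"
    using Rep_dn_const[of "of_nat n" g] by (simp add: dn_const_of_nat)
  then show "Rep_dn (dn_basis a * dn_basis b :: ('n, 'a) dn) f = Rep_dn (of_nat (mchoose (a + b) a) * dn_basis (a + b)) f"
    by (simp add: Rep_dn_times Rep_dn_basis dpa_dpa)
qed

text \<open>Multi-indices satisfy a + b = 0 only for a = b = 0, so no other basis products
  contribute to the constant term.\<close>

lemma coef_mult_0: "coef (x * y) 0 = coef x 0 * coef y 0"
proof (induction x rule: dn_induct)
  case (single a c)
  show ?case
  proof (induction y rule: dn_induct)
    case (single b d)
    have "dn_const c * dn_basis a * (dn_const d * dn_basis b) = dn_const c * (dn_const d * (of_nat (mchoose (a + b) a) * dn_basis (a + b)))"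
      unfolding dn_basis_mult[symmetric] by (simp only: mult_ac)
    moreover have "0 = a + b \<longleftrightarrow> a = 0 \<and> b = 0"
      by (auto simp: poly_mapping_eq_iff fun_eq_iff lookup_add)
    ultimately show ?case
      by (auto simp: coef_dn_const_mult coef_of_nat_mult coef_dn_basis)
  qed (simp add: distrib_left coef_add)
qed (simp add: distrib_right coef_add)

lemma coef_power_0: "coef (x ^ n) 0 = coef x 0 ^ n"
  by (induction n) (auto simp: coef_mult_0 coef_1)

lemma CHAR_dn [simp]: "CHAR(('n::finite, 'a::field) dn) = CHAR('a)"
proof (rule CHAR_eqI)
  show "of_nat CHAR('a) = (0 :: ('n, 'a) dn)"
    by (metis dn_const_of_nat of_nat_CHAR dn_const_0)
next
  fix n assume "of_nat n = (0 :: ('n, 'a) dn)"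
  then have "coef (of_nat n * 1 :: ('n, 'a) dn) 0 = 0" by simp
  then show "CHAR('a) dvd n"
    unfolding coef_of_nat_mult by (simp add: coef_1 of_nat_eq_0_iff_char_dvd)
qed

section \<open>The p-th power map on \<open>dn\<close>\<close>

lemma dn_basis_power: "\<exists>c b. (dn_basis a :: ('n::finite, 'a::field) dn) ^ n = of_nat c * dn_basis b \<and> (\<forall>i. lkp b i = n * lkp a i)"
proof (induction n)
  case 0
  show ?case by (intro exI[of _ 1] exI[of _ 0]) simp
next
  case (Suc n)
  then obtain c b where *: "(dn_basis a :: ('n, 'a) dn) ^ n = of_nat c * dn_basis b" "\<forall>i. lkp b i = n * lkp a i" by blast
  have "(dn_basis a :: ('n, 'a) dn) ^ Suc n = of_nat c * (dn_basis a * dn_basis b)"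
    by (simp add: * mult_ac)
  also have "\<dots> = of_nat (c * mchoose (a + b) a) * dn_basis (a + b)"
    by (simp add: dn_basis_mult mult_ac)
  finally show ?case using *(2)
    by (intro exI[of _ "c * mchoose (a + b) a"] exI[of _ "a + b"]) (auto simp: lookup_add)
qed

text \<open>Absorption identity, with the factor \<open>a\<close> cancelled.\<close>

lemma dvd_prime_mult_choose: assumes "0 < a" shows "p dvd ((p * a) choose a)"
proof -
  have "a * ((p * a) choose a) = a * (p * ((p * a - 1) choose (a - 1)))"
    using times_binomial_minus1_eq[OF assms, of "p * a"] by auto
  with assms have "(p * a) choose a = p * ((p * a - 1) choose (a - 1))" by simp
  then show ?thesis by simp
qed

text \<open>Split off one factor: the last structure constant contains
  \<open>(p * lkp a i) choose lkp a i\<close> for some i with \<open>lkp a i > 0\<close>, a multiple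
  of p.\<close>

lemma dn_basis_power_CHAR:
  assumes "CHAR('a::field) = p" "p > 0" "a \<noteq> 0"
  shows "(dn_basis a :: ('n::finite, 'a) dn) ^ p = 0"
proof -
  obtain i where i: "lkp a i > 0"
    using assms(3) by (metis gr0I poly_mapping_eqI lookup_zero)
  obtain c b where *: "(dn_basis a :: ('n, 'a) dn) ^ (p - 1) = of_nat c * dn_basis b" "\<forall>i. lkp b i = (p - 1) * lkp a i"
    using dn_basis_power by blast
  have "(dn_basis a :: ('n, 'a) dn) ^ p = of_nat c * (dn_basis a * dn_basis b)"
    using power_Suc[of "dn_basis a :: ('n, 'a) dn" "p - 1"] assms(2) by (simp add: *[simplified] mult_ac)
  also have "\<dots> = of_nat c * (of_nat (mchoose (a + b) a) * dn_basis (a + b))"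
    by (simp add: dn_basis_mult)
  also have "(of_nat (mchoose (a + b) a) :: ('n, 'a) dn) = 0"
  proof -
    have "lkp (a + b) i = p * lkp a i"
      using assms(2) *(2) by (cases p) (auto simp: lookup_add)
    then have "p dvd (lkp (a + b) i choose lkp a i)"
      using dvd_prime_mult_choose[OF i, of p] by simp
    then have "p dvd mchoose (a + b) a"
      unfolding mchoose_remove[of _ _ i] by simp
    then show ?thesis using assms(1) by (simp add: of_nat_eq_0_iff_char_dvd)
  qed
  finally show ?thesis by simp
qed

text \<open>Both sides are additive in \<open>x\<close> by the freshman's dream, and a basis element
  other than 1 has p-th power 0.\<close>

lemma power_CHAR_dn:
  fixes x :: "('n::finite, 'a::field) dn"
  assumes "CHAR('a) = p" "prime p"
  shows "x ^ p = dn_const (coef x 0 ^ p)"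
proof (induction x rule: dn_induct)
  case (single a c)
  show ?case
  proof (cases "a = 0")
    case False
    then have "(dn_basis a :: ('n, 'a) dn) ^ p = 0"
      using assms dn_basis_power_CHAR[of p a] by (simp add: prime_gt_0_nat)
    then show ?thesis using False assms
      by (simp add: power_mult_distrib coef_dn_const_mult coef_dn_basis zero_power prime_gt_0_nat)
  qed (simp add: coef_dn_const dn_const_power)
next
  case (add x y)
  have "(x + y) ^ p = x ^ p + y ^ p"
    using freshmans_dream[where ?'a = "('n, 'a) dn"] assms by simp
  moreover have "(coef x 0 + coef y 0) ^ p = coef x 0 ^ p + coef y 0 ^ p"
    using freshmans_dream[where ?'a = 'a] assms by simp
  ultimately show ?case using add by (simp add: coef_add dn_const_add)
qed

section \<open>Binomial coefficients modulo the characteristic\<close>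

lemma prime_dvd_prime_power_choose:
  assumes "prime (p::nat)" "0 < k" "k < p ^ s"
  shows "p dvd ((p ^ s) choose k)"
proof (rule ccontr)
  assume "\<not> p dvd ((p ^ s) choose k)"
  then have cop: "coprime (p ^ s) ((p ^ s) choose k)"
    using assms(1) by (simp add: prime_imp_coprime)
  \<comment> \<open>By absorption and coprimality p^s would divide k, which is too small.\<close>
  have "k * ((p ^ s) choose k) = p ^ s * ((p ^ s - 1) choose (k - 1))"
    using times_binomial_minus1_eq[OF assms(2), of "p ^ s"] by simp
  then have "p ^ s dvd k * ((p ^ s) choose k)" by simp
  with cop have "p ^ s dvd k" by (simp add: coprime_dvd_mult_left_iff)
  with assms show False by (auto dest: dvd_imp_le)
qed

text \<open>In the Vandermonde sum only the terms k = 0 and k = p^s survive, since p divides the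
  other \<open>(p ^ s) choose k\<close>.\<close>

lemma additive_exponent_prime_power:
  assumes "CHAR('a::field) = p" "prime p"
  shows "additive_exponent TYPE('a) (p ^ s)"
  unfolding additive_exponent_def
proof (intro allI)
  fix m a
  let ?q = "p ^ s"
  let ?t = "\<lambda>k. (of_nat (?q choose k) * of_nat (m choose (a - k)) :: 'a)"
  have q: "?q > 0" using assms(2) by (simp add: prime_gt_0_nat)
  have z: "?t k = 0" if "k \<noteq> 0" "k \<noteq> ?q" for k
  proof (cases "k < ?q")
    case True
    then have "p dvd (?q choose k)"
      using that assms(2) by (intro prime_dvd_prime_power_choose) auto
    then have "(of_nat (?q choose k) :: 'a) = 0" using assms(1) by (simp add: of_nat_eq_0_iff_char_dvd)
    then show ?thesis by simp
  next
    case False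
    then show ?thesis using that by (simp add: binomial_eq_0)
  qed
  have "(of_nat ((m + ?q) choose a) :: 'a) = (\<Sum>k\<le>a. ?t k)"
    using arg_cong[OF vandermonde[of ?q m a], of "of_nat :: nat \<Rightarrow> 'a"] by (simp add: add.commute)
  also have "\<dots> = (\<Sum>k\<in>{0, ?q} \<inter> {..a}. ?t k)"
    by (rule sum.mono_neutral_right) (use z in auto)
  also have "\<dots> = of_nat (m choose a) + (if ?q \<le> a then of_nat (m choose (a - ?q)) else 0)"
    using q by auto
  finally show "(of_nat ((m + ?q) choose a) :: 'a) =
    of_nat (m choose a) + (if ?q \<le> a then of_nat (m choose (a - ?q)) else 0)" .
qed

text \<open>One step of Lucas' theorem, for the base \<open>q\<close> a power of the characteristic.\<close>

lemma choose_lucas: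
  assumes "additive_exponent TYPE('a::field) q" "a0 < q" "b0 < q"
  shows "(of_nat ((q * a + a0) choose (q * b + b0)) :: 'a) = of_nat (a choose b) * of_nat (a0 choose b0)"
proof (induction a arbitrary: b)
  case 0
  show ?case
  proof (cases b)
    case (Suc b')
    then have "a0 < q * b + b0" using assms(2) by simp
    then show ?thesis using Suc by (simp add: binomial_eq_0)
  qed simp
next
  case (Suc a)
  have *: "(of_nat ((q * Suc a + a0) choose (q * b + b0)) :: 'a) = of_nat ((q * a + a0) choose (q * b + b0)) +
      (if q \<le> q * b + b0 then of_nat ((q * a + a0) choose (q * b + b0 - q)) else 0)"
    using assms(1)[unfolded additive_exponent_def, rule_format, of "q * a + a0" "q * b + b0"]
    by (simp add: algebra_simps)
  show ?case
  proof (cases b)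
    case 0
    then show ?thesis using * Suc.IH[of 0] assms(3) by simp
  next
    case (Suc b')
    then show ?thesis using * Suc.IH[of b] Suc.IH[of b'] by (simp add: distrib_right)
  qed
qed

text \<open>Raising \<open>a\<close> by one adds \<open>(q * a) choose 0\<close>, which is
  1.\<close>

lemma choose_mult_self:
  assumes "additive_exponent TYPE('a::field) q" "q > 0"
  shows "(of_nat ((q * a) choose q) :: 'a) = of_nat a"
proof (induction a)
  case 0
  then show ?case using assms(2) by (simp add: binomial_eq_0)
next
  case (Suc a)
  then show ?case
    using assms(1)[unfolded additive_exponent_def, rule_format, of "q * a" q] by (simp add: algebra_simps)
qed

subsection \<open>The derivations induced by the Frobenius powers of the variables, and divided powers\<close>

lemma Rep_dn_power: "Rep_dn (x ^ n) = Rep_dn x ^^ n"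
  by (induction n) (auto simp: Rep_dn_ring id_def)

lemma lookup_shift:
  "lkp (sgl (sgl i n) 1 * c) a = (if n \<le> lkp a i then lkp c (a - sgl i n) else 0)"
  for c :: "('n \<Rightarrow>\<^sub>0 nat) \<Rightarrow>\<^sub>0 'a::comm_semiring_1"
proof (induction c rule: poly_mapping_additive_induct)
  case (single m c)
  have "sgl i n + m = a \<longleftrightarrow> n \<le> lkp a i \<and> m = a - sgl i n"
  proof (intro iffI conjI)
    assume "n \<le> lkp a i \<and> m = a - sgl i n"
    then show "sgl i n + m = a"
      by (intro poly_mapping_eqI) (auto simp: lookup_add lookup_minus lookup_single when_def)
  qed (auto simp: lookup_add)
  then show ?case by (auto simp: mult_single lookup_single when_def)
qed (auto simp: distrib_left lookup_add)

text \<open>Coefficient families are polynomials in disguise; this turns the iterates of integration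
  into products with monomials.\<close>

lemma intc_eq_shift: "intc i c = sgl (sgl i 1) 1 * c"
proof (rule additive_eqI[where S = "intc i"])
  show "intc i (f + g) = intc i f + intc i g" for f g :: "('a \<Rightarrow>\<^sub>0 nat) \<Rightarrow>\<^sub>0 'b"
    unfolding intc_def by (rule setsum_keys_plus_distrib) (auto simp: single_add)
qed (auto simp: intc_def mult_single distrib_left add.commute)

lemma intst_dopK: "intst i (dopK c) = dopK (sgl (sgl i 1) 1 * c)"
  by (simp add: intst_def dopK_inject intc_eq_shift)

lemma intst_funpow_dopK: "(intst i ^^ n) (dopK c) = dopK (sgl (sgl i n) 1 * c)"
proof (induction n)
  case (Suc n)
  have "sgl (sgl i 1) 1 * (sgl (sgl i n) 1 * c) = sgl (sgl i (Suc n)) 1 * c"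
    by (simp add: mult_single flip: mult.assoc single_add)
  with Suc show ?case by (simp add: intst_dopK)
qed simp

text \<open>The divided power \<open>x\<^sup>n/n!\<close>, meaningful for \<open>n\<close> below the characteristic.\<close>

definition divpow :: "('n::finite, 'a::field) dn \<Rightarrow> nat \<Rightarrow> ('n, 'a) dn"
  where "divpow x n = dn_const (inverse (of_nat (fact n))) * x ^ n"

lemma divpow_0 [simp]: "divpow x 0 = 1"
  by (simp add: divpow_def)

lemma Rep_divpow: "Rep_dn (divpow x n) = smulop (inverse (of_nat (fact n))) (Rep_dn x ^^ n)"
  by (simp add: divpow_def Rep_dn_const_mult Rep_dn_power)

locale frob_setup =
  fixes ty :: "('n::finite \<times> 'a::field) itself" and p s :: nat
  assumes CHAR: "CHAR('a) = p" and prime_p: "prime p"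
begin

abbreviation "q \<equiv> p ^ s"

lemma p_pos: "p > 0" and p_gt_1: "p > 1"
  using prime_gt_1_nat[OF prime_p] by simp_all

lemma p_mod_div: assumes "m = p * a + b" "b < p" shows "m mod p = b" "m div p = a"
  using assms by auto

lemma q_pos: "q > 0"
  using p_pos by simp

lemma additive_q: "additive_exponent TYPE('a) (p ^ t)"
  using additive_exponent_prime_power CHAR prime_p by blast

definition der :: "'n \<Rightarrow> ('n, 'a) dn \<Rightarrow> ('n, 'a) dn" where
  "der j x = Abs_dn (\<lambda>f. Rep_dn x (sgl (sgl j q) 1 * f) - sgl (sgl j q) 1 * Rep_dn x f)"

lemma commutator_X_single:
  "(\<lambda>f. smulop c (dpa a) (sgl (sgl j q) 1 * f) - sgl (sgl j q) 1 * smulop c (dpa a) f) =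
   (if q \<le> lkp a j then smulop c (dpa (a - sgl j q)) else (\<lambda>f. 0))" for c :: 'a and a :: "'n \<Rightarrow>\<^sub>0 nat"
  by (auto simp: smulop_def dpa_X_mult[OF additive_q] fun_eq_iff distrib_left mult.left_commute)

text \<open>Justifies \<open>Abs_dn\<close> in \<open>der\<close>: the two products with x_j^q leave
  \<open>Dn\<close> in general, their difference does not.\<close>

lemma commutator_X_in_Dn:
  fixes T :: "('n, 'a) op"
  assumes "T \<in> Dn"
  shows "(\<lambda>f. T (sgl (sgl j q) 1 * f) - sgl (sgl j q) 1 * T f) \<in> Dn"
  using assms
proof (induction rule: Dn_induct)
  case (single a c)
  then show ?case unfolding commutator_X_single by (simp add: smulop_dpa_in_Dn zero_in_Dn)
next
  case (add S T)
  show ?case using opadd_in_Dn[OF add(3,4)] by (simp add: opadd_def algebra_simps)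
qed

lemma Rep_der: "Rep_dn (der j x) f = Rep_dn x (sgl (sgl j q) 1 * f) - sgl (sgl j q) 1 * Rep_dn x f"
  by (simp add: der_def Abs_dn_inverse commutator_X_in_Dn)

lemma der_0 [simp]: "der j 0 = 0"
  by (rule dn_eqI) (simp add: Rep_der Rep_dn_ring)

lemma der_1 [simp]: "der j 1 = 0"
  by (rule dn_eqI) (simp add: Rep_der Rep_dn_ring)

lemma der_add: "der j (x + y) = der j x + der j y"
  by (rule dn_eqI) (simp add: Rep_der Rep_dn_ring opadd_def algebra_simps)

lemma der_minus: "der j (x - y) = der j x - der j y"
  by (rule dn_eqI) (simp add: Rep_der Rep_dn_ring opsub_def algebra_simps)

lemma Rep_dn_diff_arg: "Rep_dn x (f - g) = Rep_dn x f - Rep_dn x g"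
  by (metis Rep_dn_add_arg add_diff_cancel diff_add_cancel)

text \<open>A commutator with a fixed operator obeys the product rule formally, given additivity of
  the operators.\<close>

lemma der_mult: "der j (x * y) = der j x * y + x * der j y"
  by (rule dn_eqI) (simp add: Rep_der Rep_dn_ring opadd_def Rep_dn_diff_arg)

lemma der_dn_const [simp]: "der j (dn_const c) = 0"
  by (rule dn_eqI) (simp add: Rep_der Rep_dn_const Rep_dn_zero mult_ac)

lemma der_dn_const_mult: "der j (dn_const c * x) = dn_const c * der j x"
  by (simp add: der_mult)

lemma der_dn_basis: "der j (dn_basis a) = (if q \<le> lkp a j then dn_basis (a - sgl j q) else 0)"
  by (rule dn_eqI) (simp add: Rep_der Rep_dn_basis Rep_dn_zero dpa_X_mult[OF additive_q])

lemma coef_der: "coef (der j x) a = coef x (a + sgl j q)"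
proof (induction x rule: dn_induct)
  case (single b c)
  have "q \<le> lkp b j \<and> a = b - sgl j q \<longleftrightarrow> a + sgl j q = b"
  proof (intro iffI conjI)
    assume "q \<le> lkp b j \<and> a = b - sgl j q"
    then show "a + sgl j q = b"
      by (intro poly_mapping_eqI) (auto simp: lookup_add lookup_minus lookup_single when_def)
  qed (auto simp: lookup_add)
  then show ?case by (auto simp: der_dn_const_mult coef_dn_const_mult der_dn_basis coef_dn_basis)
qed (auto simp: der_add coef_add)

lemma der_prod_zero: "finite A \<Longrightarrow> (\<And>i. i \<in> A \<Longrightarrow> der j (f i) = 0) \<Longrightarrow> der j (\<Prod>i\<in>A. f i) = 0"
  by (induction A rule: finite_induct) (auto simp: der_mult)

lemma der_power: "der j (x ^ Suc n) = of_nat (Suc n) * x ^ n * der j x"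
  by (induction n) (simp_all add: der_mult algebra_simps)

text \<open>A nonzero coefficient at \<open>a\<close> with \<open>q \<le> lkp a j\<close> would
  reappear in \<open>der j x\<close> at \<open>a - sgl j q\<close>.\<close>

lemma der_all_zero_coef:
  assumes "\<And>j. der j x = 0" "coef x a \<noteq> 0"
  shows "lkp a j < q"
proof (rule ccontr)
  assume "\<not> lkp a j < q"
  then have "(a - sgl j q) + sgl j q = a"
    by (intro poly_mapping_eqI) (auto simp: lookup_add lookup_minus lookup_single when_def)
  then have "coef (der j x) (a - sgl j q) = coef x a" by (simp add: coef_der)
  with assms show False by simp
qed

section \<open>The section of \<open>der\<close> given by iterated integration\<close>

definition shift :: "'n \<Rightarrow> ('n, 'a) dn \<Rightarrow> ('n, 'a) dn"
  where "shift i x = Abs_dn (intpow p s i (Rep_dn x))"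

lemma shift_dn_of: "shift i (dn_of c) = dn_of (sgl (sgl i q) 1 * c)"
  by (simp add: shift_def intpow_def Rep_dn_of intst_funpow_dopK) (simp add: dn_of_def)

lemma Rep_shift: "Rep_dn (shift i x) = intpow p s i (Rep_dn x)"
proof -
  obtain c where "x = dn_of c" using dn_of_surj by blast
  then show ?thesis by (simp add: shift_dn_of intpow_def Rep_dn_of intst_funpow_dopK)
qed

lemma coef_shift: "coef (shift i x) a = (if q \<le> lkp a i then coef x (a - sgl i q) else 0)"
proof -
  obtain c where "x = dn_of c" using dn_of_surj by blast
  then show ?thesis by (simp add: shift_dn_of coef_dn_of lookup_shift)
qed

lemma shift_1: "shift i 1 = dn_basis (sgl i q)"
proof -
  have "(1 :: ('n, 'a) dn) = dn_of 1" using dn_const_1 by (metis dn_const_def single_one)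
  then have "shift i 1 = shift i (dn_of 1)" by simp
  then show ?thesis unfolding shift_dn_of by (simp add: dn_basis_def)
qed

lemma coef_shift_0: "coef (shift i x) 0 = 0"
  unfolding coef_shift lookup_zero using q_pos by (metis not_le)

lemma der_shift_same: "der i (shift i x) = x"
  by (rule dn_eq_coefI) (simp add: coef_der coef_shift lookup_add)

lemma der_shift_other:
  assumes "i \<noteq> j" shows "der j (shift i x) = shift i (der j x)"
proof (rule dn_eq_coefI)
  fix a
  have "q \<le> lkp a i \<Longrightarrow> a + sgl j q - sgl i q = a - sgl i q + sgl j q"
    using assms by (intro poly_mapping_eqI) (auto simp: lookup_add lookup_minus lookup_single when_def)
  then show "coef (der j (shift i x)) a = coef (shift i (der j x)) a"
    using assms by (simp add: coef_der coef_shift lookup_add lookup_single)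
qed

lemma shift_0: "shift i 0 = 0"
  by (rule dn_eq_coefI) (simp add: coef_shift)

section \<open>Nilpotency, and divided powers below the characteristic\<close>

lemma power_p_eq_0: "coef x 0 = 0 \<Longrightarrow> x ^ p = 0" for x :: "('n, 'a) dn"
  using power_CHAR_dn[OF CHAR prime_p, of x] p_pos by (simp add: zero_power)

text \<open>The constant term is multiplicative and a field has no nilpotents. With the preceding
  lemma, x^p = 0 characterises a vanishing constant term, matching the exclusion of the exponent 0
  in \<open>Mset\<close>.\<close>

lemma coef_eq_0_if_power_p: "x ^ p = 0 \<Longrightarrow> coef x 0 = 0" for x :: "('n, 'a) dn"
  using coef_power_0[of x p] by simp

lemma fact_nonzero: "n < p \<Longrightarrow> (of_nat (fact n) :: 'a) \<noteq> 0"
  using CHAR prime_p by (simp add: of_nat_eq_0_iff_char_dvd prime_dvd_fact_iff del: of_nat_fact)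

text \<open>\<open>fact n\<close> is invertible for n < p. This integer equation can be transported
  along \<open>Gdn\<close>, which raises constants such as 1/n! to the power q.\<close>

lemma divpow_unique:
  fixes x :: "('n, 'a) dn"
  assumes "n < p" "of_nat (fact n) * w = x ^ n"
  shows "w = divpow x n"
proof -
  have "divpow x n = dn_const (inverse (of_nat (fact n))) * (dn_const (of_nat (fact n)) * w)"
    by (simp only: divpow_def dn_const_of_nat assms(2))
  also have "\<dots> = dn_const (inverse (of_nat (fact n)) * of_nat (fact n)) * w"
    by (simp only: dn_const_mult mult.assoc)
  also have "\<dots> = w" using fact_nonzero[OF assms(1)] by (simp del: of_nat_fact)
  finally show ?thesis by simp
qed

lemma fact_mult_divpow: "n < p \<Longrightarrow> of_nat (fact n) * divpow x n = x ^ n" for x :: "('n, 'a) dn"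
proof -
  assume "n < p"
  have "of_nat (fact n) * divpow x n = dn_const (of_nat (fact n) * inverse (of_nat (fact n))) * x ^ n"
    by (simp only: divpow_def dn_const_mult dn_const_of_nat mult.assoc)
  then show ?thesis using fact_nonzero[OF \<open>n < p\<close>] by (simp del: of_nat_fact)
qed

lemma divpow_mult:
  fixes x :: "('n, 'a) dn"
  assumes "a + b < p"
  shows "divpow x a * divpow x b = of_nat ((a + b) choose a) * divpow x (a + b)"
proof -
  have "fact (a + b) = (fact a * fact b * ((a + b) choose a) :: nat)"
    using binomial_fact_lemma[of a "a + b"] by simp
  then have "(of_nat (fact (a + b)) :: 'a) = of_nat (fact a) * of_nat (fact b) * of_nat ((a + b) choose a)"
    by (simp only: of_nat_mult)
  then have *: "inverse (of_nat (fact a)) * inverse (of_nat (fact b)) =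
      of_nat ((a + b) choose a) * (inverse (of_nat (fact (a + b))) :: 'a)"
    using fact_nonzero[of a] fact_nonzero[of b] fact_nonzero[OF assms] assms
    by (auto simp: field_simps simp del: of_nat_fact)
  have "divpow x a * divpow x b = dn_const (inverse (of_nat (fact a)) * inverse (of_nat (fact b))) * x ^ (a + b)"
    by (simp only: divpow_def dn_const_mult power_add mult_ac)
  also have "\<dots> = of_nat ((a + b) choose a) * divpow x (a + b)"
    by (simp only: * divpow_def dn_const_mult dn_const_of_nat mult_ac)
  finally show ?thesis .
qed

lemma divpow_mult_eq_0:
  fixes x :: "('n, 'a) dn"
  assumes "x ^ p = 0" "a + b \<ge> p"
  shows "divpow x a * divpow x b = 0"
proof -
  have "x ^ (a + b) = x ^ p * x ^ (a + b - p)" using assms(2) by (simp flip: power_add)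
  then have "x ^ a * x ^ b = 0" using assms(1) by (simp add: power_add)
  moreover have "divpow x a * divpow x b =
      dn_const (inverse (of_nat (fact a))) * dn_const (inverse (of_nat (fact b))) * (x ^ a * x ^ b)"
    by (simp only: divpow_def mult_ac)
  ultimately show ?thesis by simp
qed

lemma der_divpow:
  assumes "Suc n < p" shows "der j (divpow x (Suc n)) = divpow x n * der j x"
proof -
  have "fact (Suc n) = (Suc n * fact n :: nat)" by (simp add: fact_Suc)
  then have "(of_nat (fact (Suc n)) :: 'a) = of_nat (Suc n) * of_nat (fact n)"
    by (simp only: of_nat_mult)
  then have "of_nat (Suc n) * inverse (of_nat (fact (Suc n))) = inverse (of_nat (fact n) :: 'a)"
    using fact_nonzero[OF assms] by (simp del: of_nat_fact of_nat_Suc fact_Suc)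
  then have "dn_const (inverse (of_nat (fact n))) = of_nat (Suc n) * (dn_const (inverse (of_nat (fact (Suc n)))) :: ('n, 'a) dn)"
    by (metis dn_const_mult dn_const_of_nat)
  moreover have "der j (divpow x (Suc n)) = dn_const (inverse (of_nat (fact (Suc n)))) * (of_nat (Suc n) * x ^ n * der j x)"
    by (simp only: divpow_def der_dn_const_mult der_power)
  ultimately show ?thesis
    by (simp only: divpow_def mult_ac)
qed

section \<open>Divided powers assembled from base p digits\<close>

definition digpow :: "(nat \<Rightarrow> ('n, 'a) dn) \<Rightarrow> nat \<Rightarrow> nat \<Rightarrow> ('n, 'a) dn"
  where "digpow Y N m = (\<Prod>k<N. divpow (Y k) ((m div p ^ k) mod p))"

lemma digpow_0_right [simp]: "digpow Y N 0 = 1"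
  by (simp add: digpow_def)

text \<open>Removing the lowest digit shifts the family \<open>Y\<close>; the inductions on the
  number of digits run along this recursion.\<close>

lemma digpow_Suc:
  "digpow Y (Suc N) m = divpow (Y 0) (m mod p) * digpow (\<lambda>k. Y (Suc k)) N (m div p)"
  unfolding digpow_def by (subst prod.lessThan_Suc_shift) (simp add: div_mult2_eq)

lemma digpow_mono:
  assumes "m < p ^ N" "N \<le> M" shows "digpow Y M m = digpow Y N m"
proof -
  have "divpow (Y k) ((m div p ^ k) mod p) = 1" if "N \<le> k" for k
  proof -
    have "p ^ N \<le> p ^ k" using that p_pos by (simp add: power_increasing)
    with assms(1) have "m < p ^ k" by simp
    then show ?thesis by simp
  qed
  then show ?thesis unfolding digpow_def
    using assms(2) by (intro prod.mono_neutral_right) auto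
qed

text \<open>Compare lowest digits. Without a carry they multiply as ordinary divided powers and
  Lucas' theorem splits the binomial. With a carry both sides vanish: the left since
  \<open>Y 0 ^ p = 0\<close>, the right since the lowest digit of a + b falls below that of
  a.\<close>

lemma digpow_mult:
  assumes "\<And>k. Y k ^ p = 0" "a + b < p ^ N"
  shows "digpow Y N a * digpow Y N b = of_nat ((a + b) choose a) * digpow Y N (a + b)"
  using assms
proof (induction N arbitrary: Y a b)
  case (Suc N)
  let ?Y = "\<lambda>k. Y (Suc k)"
  define a0 b0 a1 b1 where ab: "a0 = a mod p" "b0 = b mod p" "a1 = a div p" "b1 = b div p"
  have a: "a = p * a1 + a0" and b: "b = p * b1 + b0" using ab by auto
  have lt: "a0 < p" "b0 < p" using ab p_pos by auto
  have split: "digpow Y (Suc N) a * digpow Y (Suc N) b =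
     (divpow (Y 0) a0 * divpow (Y 0) b0) * (digpow ?Y N a1 * digpow ?Y N b1)"
    by (simp add: digpow_Suc ab mult_ac)
  \<comment> \<open>Lucas in base p, with the digits of a + b above and those of a below.\<close>
  have luc: "(of_nat ((a + b) choose a) :: ('n, 'a) dn) =
     of_nat (((a + b) div p) choose a1) * of_nat (((a + b) mod p) choose a0)"
    using arg_cong[OF choose_lucas[OF additive_q[of 1], of "(a + b) mod p" a0 "(a + b) div p" a1], of dn_const] lt p_pos
    by (simp add: dn_const_mult dn_const_of_nat flip: a)
  show ?case
  proof (cases "a0 + b0 < p")
    case True
    have d: "(a + b) mod p = a0 + b0" "(a + b) div p = a1 + b1"
    proof -
      have "a + b = p * (a1 + b1) + (a0 + b0)" using a b by (simp add: algebra_simps)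
      then show "(a + b) mod p = a0 + b0" "(a + b) div p = a1 + b1" using True by auto
    qed
    have "(a + b) div p < p ^ N" using Suc.prems(2) by (simp add: less_mult_imp_div_less mult.commute)
    then have "a1 + b1 < p ^ N" by (simp add: d)
    then have IH: "digpow ?Y N a1 * digpow ?Y N b1 = of_nat ((a1 + b1) choose a1) * digpow ?Y N (a1 + b1)"
      by (intro Suc.IH Suc.prems(1))
    show ?thesis
      by (simp only: split IH divpow_mult[OF True]) (simp only: luc d digpow_Suc mult_ac)
  next
    case False
    have "a + b = p * (a1 + b1 + 1) + (a0 + b0 - p)" "a0 + b0 - p < p"
      using a b lt False by (auto simp: algebra_simps)
    then have "(a + b) mod p = a0 + b0 - p" by (metis mod_mult_self4 mod_less)
    then have "((a + b) mod p) choose a0 = 0" using lt False by (simp add: binomial_eq_0)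
    then have "(of_nat ((a + b) choose a) :: ('n, 'a) dn) = 0"
      by (simp only: luc of_nat_0 mult_zero_right)
    moreover have "divpow (Y 0) a0 * divpow (Y 0) b0 = 0"
      using False Suc.prems(1)[of 0] by (intro divpow_mult_eq_0) auto
    ultimately show ?thesis unfolding split by simp
  qed
qed simp

text \<open>The index counts down like an odometer: a positive lowest digit drops by one, while the
  other term of the product rule dies by \<open>Y 0 ^ p = 0\<close>; a zero lowest digit borrows and
  becomes p - 1. \<open>e\<close> is arbitrary so that the shifted family can absorb
  \<open>divpow (Y 0) (p - 1)\<close>.\<close>

lemma der_digpow:
  assumes "\<And>k. Y k ^ p = 0" "\<And>k. der j (Y k) = e * (\<Prod>l<k. divpow (Y l) (p - 1))" "m < p ^ N"
  shows "der j (digpow Y N m) = (if m = 0 then 0 else e * digpow Y N (m - 1))"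
  using assms
proof (induction N arbitrary: Y e m)
  case (Suc N)
  let ?Y = "\<lambda>k. Y (Suc k)"
  let ?e = "e * divpow (Y 0) (p - 1)"
  define m0 m1 where m01: "m0 = m mod p" "m1 = m div p"
  have m: "m = p * m1 + m0" and lt: "m0 < p" using m01 p_pos by auto
  have "m1 < p ^ N" using Suc.prems(3) m01 by (simp add: less_mult_imp_div_less mult.commute)
  moreover have "der j (Y (Suc k)) = ?e * (\<Prod>l<k. divpow (Y (Suc l)) (p - 1))" for k
    unfolding Suc.prems(2) by (subst prod.lessThan_Suc_shift) (simp add: mult_ac)
  ultimately have IH: "der j (digpow ?Y N m1) = (if m1 = 0 then 0 else ?e * digpow ?Y N (m1 - 1))"
    by (intro Suc.IH) (use Suc.prems(1) in auto)
  have d0: "der j (Y 0) = e" using Suc.prems(2)[of 0] by simp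
  have split: "der j (digpow Y (Suc N) m) =
    der j (divpow (Y 0) m0) * digpow ?Y N m1 + divpow (Y 0) m0 * der j (digpow ?Y N m1)"
    by (simp add: digpow_Suc m01 der_mult)
  show ?case
  proof (cases m0)
    case 0
    show ?thesis
    proof (cases m1)
      case (Suc m2)
      have "m - 1 = p * m2 + (p - 1)" using m 0 Suc p_pos by simp
      then have "(m - 1) mod p = p - 1" "(m - 1) div p = m2" by (rule p_mod_div; use p_pos in simp)+
      then show ?thesis using split IH 0 Suc m p_pos
        by (simp add: digpow_Suc mult_ac)
    qed (use split IH 0 m in simp)
  next
    case (Suc m2)
    have "divpow (Y 0) m0 * divpow (Y 0) (p - 1) = 0"
      using Suc Suc.prems(1)[of 0] by (intro divpow_mult_eq_0) auto
    then have "divpow (Y 0) m0 * der j (digpow ?Y N m1) = 0"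
      unfolding IH by (simp add: mult.left_commute[of _ e] flip: mult.assoc) (simp add: mult_ac)
    moreover have "der j (divpow (Y 0) m0) = divpow (Y 0) m2 * e"
      using der_divpow[of m2] lt Suc d0 by simp
    moreover have "(m - 1) mod p = m2" "(m - 1) div p = m1"
    proof -
      have "m - 1 = p * m1 + m2" using m Suc by simp
      then show "(m - 1) mod p = m2" "(m - 1) div p = m1" using lt Suc by auto
    qed
    ultimately show ?thesis using split m Suc by (simp add: digpow_Suc mult_ac)
  qed
qed simp

text \<open>\<open>Suc m\<close> digits, the range used in \<open>yj\<close>, always cover
  m.\<close>

definition divpows :: "(nat \<Rightarrow> ('n, 'a) dn) \<Rightarrow> nat \<Rightarrow> ('n, 'a) dn"
  where "divpows Y m = digpow Y (Suc m) m"

lemma less_p_power: "m < p ^ Suc m"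
proof -
  have "m < p ^ m" using p_gt_1 by (intro power_gt_expt) auto
  also have "\<dots> \<le> p ^ Suc m" using p_pos by simp
  finally show ?thesis .
qed

lemma divpows_eq: "m < p ^ N \<Longrightarrow> divpows Y m = digpow Y N m"
  unfolding divpows_def using digpow_mono less_p_power by (metis nle_le)

lemma divpows_0 [simp]: "divpows Y 0 = 1"
  by (simp add: divpows_def)

lemma divpows_mult:
  assumes "\<And>k. Y k ^ p = 0"
  shows "divpows Y a * divpows Y b = of_nat ((a + b) choose a) * divpows Y (a + b)"
proof -
  have "a + b < p ^ Suc (a + b)" by (rule less_p_power)
  moreover from this have "a < p ^ Suc (a + b)" "b < p ^ Suc (a + b)" by linarith+
  ultimately show ?thesis using digpow_mult[OF assms] by (simp only: divpows_eq)
qed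

lemma der_divpows:
  assumes "\<And>k. Y k ^ p = 0" "\<And>k. der j (Y k) = e * (\<Prod>l<k. divpow (Y l) (p - 1))"
  shows "der j (divpows Y m) = (if m = 0 then 0 else e * divpows Y (m - 1))"
proof -
  have "m < p ^ Suc m" by (rule less_p_power)
  moreover from this have "m - 1 < p ^ Suc m" by linarith
  ultimately show ?thesis using der_digpow[OF assms] by (simp only: divpows_eq)
qed

lemma divpows_p_power: "divpows Y (p ^ k) = Y k"
proof -
  have lt: "p ^ k < p ^ Suc k" using p_gt_1 by simp
  have "divpow (Y l) ((p ^ k div p ^ l) mod p) = 1" if "l < k" for l
  proof -
    have "p ^ k div p ^ l = p ^ (k - l)" using that p_pos by (simp add: power_diff)
    also have "\<dots> mod p = 0" using that by simp
    finally show ?thesis by simp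
  qed
  then have "digpow Y (Suc k) (p ^ k) = divpow (Y k) 1"
    unfolding digpow_def prod.lessThan_Suc using p_gt_1 by simp
  then show ?thesis using divpows_eq[OF lt] by (simp add: divpow_def)
qed

text \<open>All k digits of p^k - 1 equal p - 1, so the product in the recursion of
  \<open>ypq\<close> is the divided power of index p^k - 1.\<close>

lemma divpows_p_power_minus_1: "divpows Y (p ^ k - 1) = (\<Prod>l<k. divpow (Y l) (p - 1))"
proof -
  have "p ^ k - 1 < p ^ k" using p_pos by simp
  moreover have "digpow Y k (p ^ k - 1) = (\<Prod>l<k. divpow (Y l) (p - 1))"
  proof (induction k arbitrary: Y)
    case (Suc k)
    have "p ^ Suc k - 1 = p * (p ^ k - 1) + (p - 1)"
      using p_pos by (simp add: algebra_simps)
    then have "(p ^ Suc k - 1) mod p = p - 1" "(p ^ Suc k - 1) div p = p ^ k - 1"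
      by (rule p_mod_div; use p_pos in simp)+
    then show ?case by (simp only: digpow_Suc Suc prod.lessThan_Suc_shift comp_def)
  qed (simp add: digpow_def)
  ultimately show ?thesis by (simp add: divpows_eq)
qed

end

subsection \<open>The families \<open>y\<^sub>u\<close>\<close>

lemma fold_comp_Rep:
  "fold (\<lambda>k acc. acc \<circ> Rep_dn (g k)) [0..<n] id = Rep_dn (\<Prod>k<n. g k)"
  by (induction n) (simp_all add: Rep_dn_ring)

text \<open>Composition in \<open>Dn\<close> is commutative, so the fold in \<open>yalpha\<close>
  does not depend on the order of the variables.\<close>

lemma Finite_Set_fold_comp_Rep:
  assumes "finite A"
  shows "Finite_Set.fold (\<lambda>i acc. Rep_dn (g i) \<circ> acc) id A = Rep_dn (\<Prod>i\<in>A. g i)"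
proof -
  interpret comp_fun_commute "\<lambda>i acc. Rep_dn (g i) \<circ> acc"
    by unfold_locales (auto simp: fun_eq_iff Dn_commute)
  show ?thesis using assms
  proof (induction A rule: finite_induct)
    case (insert i A)
    then show ?case using fold_insert[OF insert.hyps, of id] by (simp only: prod.insert Rep_dn_times not_False_eq_True)
  qed (simp add: Rep_dn_one)
qed

context frob_setup
begin

text \<open>The box condition on exponents becomes vanishing of every \<open>der j\<close>, and the
  exclusion of 0 a vanishing constant term, so membership can be checked by differentiating.\<close>

lemma Mset_iff:
  "u \<in> Mset p s \<longleftrightarrow> (\<forall>i k. u i k \<in> Dn \<and> coef (Abs_dn (u i k)) 0 = 0 \<and> (\<forall>j. der j (Abs_dn (u i k)) = 0))"
  for u :: "'n \<Rightarrow> nat \<Rightarrow> ('n, 'a) op"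
proof (intro iffI allI)
  fix i k
  assume "u \<in> Mset p s"
  then obtain c where c: "Poly_Mapping.keys c \<subseteq> {a. a \<noteq> 0 \<and> (\<forall>j. lkp a j < q)}" "u i k = dopK c"
    unfolding Mset_def by blast
  then have "Abs_dn (u i k) = dn_of c" by (simp add: dn_of_def)
  moreover have "lkp c 0 = 0" using c(1) by (auto simp: subset_iff in_keys_iff)
  moreover have "der j (dn_of c) = 0" for j
  proof (rule dn_eq_coefI)
    fix a
    \<comment> \<open>\<open>der j\<close> reads the coefficient q steps further in direction j,
      outside the box.\<close>
    have "\<not> lkp (a + sgl j q) j < q" by (simp add: lookup_add)
    then have "lkp c (a + sgl j q) = 0" using c(1) by (auto simp: subset_iff in_keys_iff)
    then show "coef (der j (dn_of c)) a = coef 0 a" by (simp add: coef_der coef_dn_of)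
  qed
  ultimately show "u i k \<in> Dn \<and> coef (Abs_dn (u i k)) 0 = 0 \<and> (\<forall>j. der j (Abs_dn (u i k)) = 0)"
    using c(2) by (simp add: Dn_def coef_dn_of)
next
  assume R: "\<forall>i k. u i k \<in> Dn \<and> coef (Abs_dn (u i k)) 0 = 0 \<and> (\<forall>j. der j (Abs_dn (u i k)) = 0)"
  have "\<exists>c. Poly_Mapping.keys c \<subseteq> {a. a \<noteq> 0 \<and> (\<forall>j. lkp a j < q)} \<and> u i k = dopK c" for i k
  proof -
    obtain c where c: "u i k = dopK c" using R unfolding Dn_def by blast
    then have A: "Abs_dn (u i k) = dn_of c" by (simp add: dn_of_def)
    have "a \<noteq> 0 \<and> (\<forall>j. lkp a j < q)" if "a \<in> Poly_Mapping.keys c" for a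
    proof
      show "a \<noteq> 0" using R[rule_format, of i k] that by (auto simp: A coef_dn_of in_keys_iff)
      have "coef (dn_of c) a \<noteq> 0" using that by (simp add: coef_dn_of in_keys_iff)
      moreover have "der j (dn_of c) = 0" for j using R[rule_format, of i k] by (simp add: A)
      ultimately show "\<forall>j. lkp a j < q" using der_all_zero_coef by blast
    qed
    with c show ?thesis by blast
  qed
  then show "u \<in> Mset p s" unfolding Mset_def by blast
qed

definition ydn :: "('n \<Rightarrow> nat \<Rightarrow> ('n, 'a) op) \<Rightarrow> 'n \<Rightarrow> nat \<Rightarrow> ('n, 'a) dn"
  where "ydn u i k = Abs_dn (ypk p s u i k)"

text \<open>The start fits the general recursion: the empty product is 1, and
  \<open>shift i 1\<close> is \<open>dn_basis (sgl i q)\<close>. Both components are carried along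
  because the second feeds the next step.\<close>

lemma ypq_eq:
  assumes "\<And>i k. u i k \<in> Dn"
  shows "ypq p s u i k = (Rep_dn (ydn u i k), Rep_dn (\<Prod>l<k. divpow (ydn u i l) (p - 1))) \<and>
         ydn u i k = Abs_dn (u i k) + shift i (\<Prod>l<k. divpow (ydn u i l) (p - 1))"
proof (induction k)
  case 0
  have "ypq p s u i 0 = (Rep_dn (Abs_dn (u i 0) + shift i 1), Rep_dn 1)"
    using assms by (simp add: Rep_dn_ring shift_1 Rep_dn_basis Abs_dn_inverse dpi_def opadd_def add.commute)
  moreover from this have "ydn u i 0 = Abs_dn (u i 0) + shift i 1"
    by (simp add: ydn_def ypk_def Rep_dn_inverse)
  ultimately show ?case by (simp only: lessThan_0 prod.empty simp_thms)
next
  case (Suc k)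
  let ?Q = "\<Prod>l<Suc k. divpow (ydn u i l) (p - 1)"
  have "ypq p s u i (Suc k) = (Rep_dn (Abs_dn (u i (Suc k)) + shift i ?Q), Rep_dn ?Q)"
    using Suc assms by (simp add: Rep_dn_ring Rep_divpow Rep_shift Abs_dn_inverse Let_def)
  moreover from this have "ydn u i (Suc k) = Abs_dn (u i (Suc k)) + shift i ?Q"
    by (simp only: ydn_def ypk_def Rep_dn_inverse fst_conv)
  ultimately show ?case by simp
qed

lemma ypk_eq: "(\<And>i k. u i k \<in> Dn) \<Longrightarrow> ypk p s u i k = Rep_dn (ydn u i k)"
  using ypq_eq by (simp add: ypk_def)

lemma ydn_eq:
  "(\<And>i k. u i k \<in> Dn) \<Longrightarrow> ydn u i k = Abs_dn (u i k) + shift i (divpows (ydn u i) (p ^ k - 1))"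
  unfolding divpows_p_power_minus_1 by (rule conjunct2[OF ypq_eq])

lemma yj_eq: "(\<And>i k. u i k \<in> Dn) \<Longrightarrow> yj p s u i m = Rep_dn (divpows (ydn u i) m)"
  unfolding yj_def divpows_def digpow_def fold_comp_Rep[symmetric]
  by (simp only: ypk_eq Rep_divpow)

definition yprod :: "('n \<Rightarrow> nat \<Rightarrow> ('n, 'a) dn) \<Rightarrow> ('n \<Rightarrow>\<^sub>0 nat) \<Rightarrow> ('n, 'a) dn"
  where "yprod Y a = (\<Prod>i\<in>UNIV. divpows (Y i) (lkp a i))"

lemma yalpha_eq: "(\<And>i k. u i k \<in> Dn) \<Longrightarrow> yalpha p s u a = Rep_dn (yprod (ydn u) a)"
  unfolding yalpha_def yprod_def by (simp only: yj_eq Finite_Set_fold_comp_Rep finite_UNIV)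

lemma yprod_single: "yprod Y (sgl i m) = divpows (Y i) m"
proof -
  have "yprod Y (sgl i m) = divpows (Y i) m * (\<Prod>j\<in>UNIV - {i}. divpows (Y j) (lkp (sgl i m) j))"
    unfolding yprod_def by (subst prod.remove[of _ i]) auto
  also have "(\<Prod>j\<in>UNIV - {i}. divpows (Y j) (lkp (sgl i m) j)) = 1"
    by (rule prod.neutral) (auto simp: lookup_single when_def)
  finally show ?thesis by simp
qed

lemma der_divpow_zero: "der j x = 0 \<Longrightarrow> der j (divpow x n) = 0"
  unfolding divpow_def der_dn_const_mult by (cases n) (simp_all add: der_power del: power_Suc)

text \<open>Neither an entry of \<open>u\<close> nor an element in the image of
  \<open>shift i\<close> has a constant term.\<close>

lemma ydn_power_p:
  assumes "u \<in> Mset p s" shows "ydn u i k ^ p = 0"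
proof -
  have D: "\<And>i k. u i k \<in> Dn" using assms by (simp add: Mset_iff)
  have "coef (ydn u i k) 0 = 0"
    using assms by (subst ydn_eq[OF D]) (simp add: coef_add coef_shift_0 Mset_iff)
  then show ?thesis by (rule power_p_eq_0)
qed

text \<open>The entry of \<open>u\<close> is killed by \<open>der j\<close>. For i = j,
  \<open>shift i\<close> is a section of \<open>der j\<close>; otherwise \<open>der j\<close> passes
  through \<open>shift i\<close> and kills the product by induction, since its factors have lower
  index.\<close>

lemma der_ydn:
  assumes "u \<in> Mset p s"
  shows "der j (ydn u i k) = of_bool (i = j) * (\<Prod>l<k. divpow (ydn u i l) (p - 1))"
proof (induction k rule: less_induct)
  case (less k)
  have D: "\<And>i k. u i k \<in> Dn" using assms by (simp add: Mset_iff)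
  have *: "der j (ydn u i k) = der j (shift i (\<Prod>l<k. divpow (ydn u i l) (p - 1)))"
    using assms by (subst ydn_eq[OF D]) (simp add: der_add Mset_iff divpows_p_power_minus_1[simplified])
  show ?case
  proof (cases "i = j")
    case True
    then show ?thesis using * by (simp add: der_shift_same)
  next
    case False
    have "der j (\<Prod>l<k. divpow (ydn u i l) (p - 1)) = 0"
      using less False by (intro der_prod_zero der_divpow_zero) auto
    then show ?thesis using * False by (simp add: der_shift_other shift_0)
  qed
qed

text \<open>The relations between the \<open>G(\<partial>\<^bsup>[\<alpha>]\<^esup>)\<close> that are equivalent to multiplicativity of \<open>G\<close>.\<close>

definition dp_family :: "(('n \<Rightarrow>\<^sub>0 nat) \<Rightarrow> ('n, 'a) dn) \<Rightarrow> bool" where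
  "dp_family z \<longleftrightarrow> z 0 = 1 \<and> (\<forall>a b. z a * z b = of_nat (mchoose (a + b) a) * z (a + b)) \<and>
     (\<forall>j a. der j (z a) = (if lkp a j = 0 then 0 else z (a - sgl j 1)))"

lemma dp_family_yprod:
  assumes "u \<in> Mset p s"
  shows "dp_family (yprod (ydn u))"
  unfolding dp_family_def
proof (intro conjI allI)
  show "yprod (ydn u) 0 = 1" by (simp add: yprod_def)
next
  fix a b
  show "yprod (ydn u) a * yprod (ydn u) b = of_nat (mchoose (a + b) a) * yprod (ydn u) (a + b)"
    using divpows_mult[OF ydn_power_p[OF assms]]
    by (simp add: yprod_def mchoose_def lookup_add flip: prod.distrib)
next
  fix j a
  let ?R = "\<lambda>a. \<Prod>i\<in>UNIV - {j}. divpows (ydn u i) (lkp a i)"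
  have split: "yprod (ydn u) a = divpows (ydn u j) (lkp a j) * ?R a" for a
    unfolding yprod_def by (rule prod.remove) auto
  \<comment> \<open>Here \<open>e\<close> is \<open>of_bool (i = j)\<close>: only the j-th factor is
    lowered, the others are constants for \<open>der j\<close>.\<close>
  note der1 = der_divpows[OF ydn_power_p[OF assms] der_ydn[OF assms]]
  have "der j (?R a) = 0"
    by (rule der_prod_zero) (auto simp: der1)
  moreover have "?R (a - sgl j 1) = ?R a"
    by (rule prod.cong) (auto simp: lookup_minus lookup_single)
  ultimately show "der j (yprod (ydn u) a) = (if lkp a j = 0 then 0 else yprod (ydn u) (a - sgl j 1))"
    by (simp add: split der_mult der1 lookup_minus)
qed

end

subsection \<open>Construction of the ring endomorphism\<close>

lemma mulop_add: "mulop (a + b) = opadd (mulop a) (mulop b)"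
  by (auto simp: mulop_def opadd_def distrib_right)

lemma mulop_mult: "mulop (a * b) = mulop a \<circ> mulop b"
  by (auto simp: mulop_def mult.assoc)

lemma dopP_add: "dopP (c + d) = opadd (dopP c) (dopP d)"
  unfolding dopP_def opadd_def
  by (rule ext, rule setsum_keys_plus_distrib) (auto simp: distrib_right)

lemma dopP_single: "dopP (sgl a b) = mulop b \<circ> dpa a"
  by (auto simp: dopP_def mulop_def)

text \<open>Apply the operator to x^a for a key \<open>a\<close> of minimal total degree:
  \<open>dpa b\<close> kills x^a unless b \<le> a, and minimality leaves only b = a, so the value is
  the coefficient at \<open>a\<close>.\<close>

lemma dopP_eq_0:
  fixes c :: "('n::finite \<Rightarrow>\<^sub>0 nat) \<Rightarrow>\<^sub>0 ('n, 'a::field) pol"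
  assumes "dopP c = (\<lambda>f. 0)"
  shows "c = 0"
proof (rule ccontr)
  assume "c \<noteq> 0"
  then have ne: "Poly_Mapping.keys c \<noteq> {}" by simp
  define d where "d a = (\<Sum>i\<in>UNIV. lkp a i)" for a :: "'n \<Rightarrow>\<^sub>0 nat"
  obtain a where a: "a \<in> Poly_Mapping.keys c" and min: "\<And>b. b \<in> Poly_Mapping.keys c \<Longrightarrow> d a \<le> d b"
    using ne ex_min_if_finite[of "d ` Poly_Mapping.keys c"] by (fastforce simp: not_less)
  have "lkp c b * dpa b (sgl a 1) = 0" if b: "b \<in> Poly_Mapping.keys c" "b \<noteq> a" for b
  proof (cases "\<exists>i. lkp a i < lkp b i")
    case True
    then have "mchoose a b = 0" using mchoose_eq_0 by blast
    then show ?thesis by (simp add: dpa_single)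
  next
    case False
    then have le: "lkp b i \<le> lkp a i" for i by (simp add: not_less)
    obtain i where "lkp b i \<noteq> lkp a i" using b(2) by (metis poly_mapping_eqI)
    then have "lkp b i < lkp a i" using le[of i] by simp
    then have "d b < d a" unfolding d_def using le by (intro sum_strict_mono_ex1) auto
    then show ?thesis using min[OF b(1)] by simp
  qed
  then have "dopP c (sgl a 1) = (\<Sum>b\<in>{a}. lkp c b * dpa b (sgl a 1))"
    unfolding dopP_def using a by (intro sum.mono_neutral_right) auto
  also have "\<dots> = lkp c a" by (simp add: dpa_single mchoose_def)
  finally have "lkp c a = 0" using assms by simp
  with a show False by (simp add: in_keys_iff)
qed

lemma dopP_inject: "dopP c = dopP d \<longleftrightarrow> c = d"
proof
  assume *: "dopP c = dopP d"
  have "dopP c = opadd (dopP (c - d)) (dopP d)" by (simp flip: dopP_add)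
  then have "dopP (c - d) = (\<lambda>f. 0)" using * by (auto simp: opadd_def fun_eq_iff)
  then show "c = d" using dopP_eq_0 by force
qed simp

lemma mulop_dpa_in_DP: "mulop b \<circ> dpa a \<in> DP"
  unfolding DP_def dopP_single[symmetric] by simp

lemma opadd_in_DP: "S \<in> DP \<Longrightarrow> T \<in> DP \<Longrightarrow> opadd S T \<in> DP"
  unfolding DP_def by (auto simp flip: dopP_add)

lemma DP_induct [consumes 1, case_names single add]:
  assumes "T \<in> DP" and "\<And>a b. P (dopP (sgl a b))"
    and "\<And>S T. S \<in> DP \<Longrightarrow> T \<in> DP \<Longrightarrow> P S \<Longrightarrow> P T \<Longrightarrow> P (opadd S T)"
  shows "P T"
proof -
  have "P (dopP c)" for c
    by (induction c rule: poly_mapping_additive_induct)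
       (auto simp: dopP_add assms DP_def)
  then show ?thesis using assms(1) by (auto simp: DP_def)
qed

lemma dpa_in_DP: "dpa a \<in> DP"
proof -
  have "mulop 1 \<circ> dpa a = dpa a" by (auto simp: mulop_def)
  then show ?thesis using mulop_dpa_in_DP by metis
qed

lemma dpa_0_eq_id: "dpa 0 = id"
  by (rule ext) simp

lemma mulop_in_DP: "mulop b \<in> DP"
  using mulop_dpa_in_DP[of b 0] by (simp add: dpa_0_eq_id)

lemma zero_in_DP: "(\<lambda>f. 0) \<in> DP"
  using mulop_in_DP[of 0] by (simp add: mulop_def)

lemma DP_arg_add: assumes "T \<in> DP" shows "T (f + g) = T f + T g"
  using assms by (induction rule: DP_induct) (auto simp: dopP_single mulop_def dpa_add opadd_def algebra_simps)

lemma Dn_subset_DP: assumes "T \<in> Dn" shows "T \<in> DP"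
  using assms
proof (induction rule: Dn_induct)
  case (single a c)
  have "smulop c (dpa a) = mulop (sgl 0 c) \<circ> dpa a" by (auto simp: smulop_def mulop_def)
  then show ?case using mulop_dpa_in_DP by metis
qed (auto intro: opadd_in_DP)

lemma single_power: "sgl m c ^ n = sgl (\<Sum>i<n. m) (c ^ n)"
  for m :: "'b::comm_monoid_add" and c :: "'c::comm_semiring_1"
  by (induction n) (simp_all add: mult_single add.commute)

context frob_setup
begin

lemma pol_power_q_add: "(f + g) ^ q = f ^ q + g ^ q" for f g :: "('n, 'a) pol"
  using freshmans_dream'[of "q" s f g] CHAR prime_p by simp

text \<open>The q-th power map is additive and fixes 1.\<close>

lemma pol_of_nat_power_q: "(of_nat n :: ('n, 'a) pol) ^ q = of_nat n"
proof (induction n)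
  case 0
  show ?case using q_pos by (simp add: zero_power)
next
  case (Suc n)
  then show ?case by (simp add: pol_power_q_add)
qed

lemma X_power_q: "(sgl (sgl j 1) 1 :: ('n, 'a) pol) ^ q = sgl (sgl j q) 1"
proof -
  have "(\<Sum>i<n. sgl j 1) = sgl j n" for n :: nat
    by (induction n) (simp_all flip: single_add)
  then show ?thesis by (simp add: single_power)
qed

lemma const_power_q: "(sgl 0 c :: ('n, 'a) pol) ^ q = sgl 0 (c ^ q)"
  by (simp add: single_power)

section \<open>The candidate endomorphism attached to a family \<open>z\<close>\<close>

definition frobP :: "(('n \<Rightarrow>\<^sub>0 nat) \<Rightarrow> ('n, 'a) dn) \<Rightarrow> (('n \<Rightarrow>\<^sub>0 nat) \<Rightarrow>\<^sub>0 ('n, 'a) pol) \<Rightarrow> ('n, 'a) op" where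
  "frobP z c = (\<lambda>f. \<Sum>a\<in>Poly_Mapping.keys c. lkp c a ^ q * Rep_dn (z a) f)"

definition frobG :: "(('n \<Rightarrow>\<^sub>0 nat) \<Rightarrow> ('n, 'a) dn) \<Rightarrow> ('n, 'a) op \<Rightarrow> ('n, 'a) op" where
  "frobG z = (\<lambda>T\<in>DP. frobP z (THE c. dopP c = T))"

lemma frobP_add: "frobP z (c + d) = opadd (frobP z c) (frobP z d)"
  unfolding frobP_def opadd_def
  by (rule ext, rule setsum_keys_plus_distrib) (use q_pos in \<open>auto simp: pol_power_q_add distrib_right zero_power\<close>)

lemma frobP_single: "frobP z (sgl a b) = mulop (b ^ q) \<circ> Rep_dn (z a)"
  using q_pos by (auto simp: frobP_def mulop_def fun_eq_iff zero_power)

lemma frobG_dopP: "frobG z (dopP c) = frobP z c"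
  by (simp add: frobG_def dopP_inject DP_def)

lemma frobG_single: "frobG z (mulop b \<circ> dpa a) = mulop (b ^ q) \<circ> Rep_dn (z a)"
  by (simp add: frobG_dopP frobP_single flip: dopP_single)

lemma frobG_add: "S \<in> DP \<Longrightarrow> T \<in> DP \<Longrightarrow> frobG z (opadd S T) = opadd (frobG z S) (frobG z T)"
  unfolding DP_def by (auto simp: frobG_dopP frobP_add simp flip: dopP_add)

lemma frobG_arg_add: "T \<in> DP \<Longrightarrow> frobG z T (f + g) = frobG z T f + frobG z T g"
  unfolding DP_def by (auto simp: frobG_dopP frobP_def Rep_dn_add_arg distrib_left sum.distrib)

lemma frobG_dpa: "frobG z (dpa a) = Rep_dn (z a)"
proof -
  have "dpa a = mulop 1 \<circ> dpa a" by (auto simp: mulop_def)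
  then have "frobG z (dpa a) = mulop (1 ^ q) \<circ> Rep_dn (z a)" by (metis frobG_single)
  then show ?thesis by (simp add: mulop_def fun_eq_iff)
qed

lemma frobG_mulop:
  assumes "dp_family z" shows "frobG z (mulop b) = mulop (b ^ q)"
  using frobG_single[of z b 0] assms by (simp add: dpa_0_eq_id dp_family_def Rep_dn_one)

text \<open>Operators \<open>S\<close> that are multiplicative as a right factor. This set is closed under
  addition and composition, so it suffices to look at generators.\<close>

definition rmult :: "(('n \<Rightarrow>\<^sub>0 nat) \<Rightarrow> ('n, 'a) dn) \<Rightarrow> ('n, 'a) op \<Rightarrow> bool" where
  "rmult z S \<longleftrightarrow> S \<in> DP \<and> (\<forall>T\<in>DP. T \<circ> S \<in> DP \<and> frobG z (T \<circ> S) = frobG z T \<circ> frobG z S)"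

text \<open>Additivity in the left factor reduces the test to left factors
  \<open>mulop b \<circ> dpa a\<close>, which span \<open>DP\<close>.\<close>

lemma rmultI:
  assumes "S \<in> DP"
    and "\<And>b a. mulop b \<circ> dpa a \<circ> S \<in> DP \<and> frobG z (mulop b \<circ> dpa a \<circ> S) = mulop (b ^ q) \<circ> Rep_dn (z a) \<circ> frobG z S"
  shows "rmult z S"
proof -
  have "T \<circ> S \<in> DP \<and> frobG z (T \<circ> S) = frobG z T \<circ> frobG z S" if "T \<in> DP" for T
    using that
  proof (induction rule: DP_induct)
    case (single a b)
    show ?case using assms(2)[of b a] by (simp only: dopP_single frobG_single simp_thms)
  next
    case (add T1 T2)
    have TS: "T1 \<circ> S \<in> DP" "T2 \<circ> S \<in> DP"
      and IH: "frobG z (T1 \<circ> S) = frobG z T1 \<circ> frobG z S" "frobG z (T2 \<circ> S) = frobG z T2 \<circ> frobG z S"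
      using add.IH by blast+
    have "opadd T1 T2 \<circ> S = opadd (T1 \<circ> S) (T2 \<circ> S)" by (auto simp: opadd_def)
    moreover have "opadd (frobG z T1 \<circ> frobG z S) (frobG z T2 \<circ> frobG z S) =
      opadd (frobG z T1) (frobG z T2) \<circ> frobG z S" by (auto simp: opadd_def)
    ultimately have "opadd T1 T2 \<circ> S \<in> DP"
      "frobG z (opadd T1 T2 \<circ> S) = frobG z (opadd T1 T2) \<circ> frobG z S"
      by (simp_all only: opadd_in_DP[OF TS] frobG_add[OF TS] frobG_add[OF add.hyps] IH)
    then show ?case by blast
  qed
  with assms(1) show ?thesis by (simp add: rmult_def)
qed

lemma rmult_comp: "rmult z S1 \<Longrightarrow> rmult z S2 \<Longrightarrow> rmult z (S1 \<circ> S2)"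
  by (simp add: rmult_def flip: comp_assoc)

lemma rmult_add:
  assumes "rmult z S1" "rmult z S2" shows "rmult z (opadd S1 S2)"
  unfolding rmult_def
proof (intro conjI ballI)
  have S: "S1 \<in> DP" "S2 \<in> DP" using assms by (auto simp: rmult_def)
  then show "opadd S1 S2 \<in> DP" by (rule opadd_in_DP)
  fix T :: "('n, 'a) op" assume T: "T \<in> DP"
  have *: "T \<circ> opadd S1 S2 = opadd (T \<circ> S1) (T \<circ> S2)"
    using DP_arg_add[OF T] by (auto simp: opadd_def)
  have TS: "T \<circ> S1 \<in> DP" "T \<circ> S2 \<in> DP" using assms T by (auto simp: rmult_def)
  then show "T \<circ> opadd S1 S2 \<in> DP" unfolding * by (rule opadd_in_DP)
  have "opadd (frobG z T \<circ> frobG z S1) (frobG z T \<circ> frobG z S2) = frobG z T \<circ> opadd (frobG z S1) (frobG z S2)"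
    using frobG_arg_add[OF T] by (auto simp: opadd_def)
  then show "frobG z (T \<circ> opadd S1 S2) = frobG z T \<circ> frobG z (opadd S1 S2)"
    unfolding * frobG_add[OF TS] frobG_add[OF S] using assms T by (simp add: rmult_def)
qed

context
  fixes z assumes z: "dp_family z"
begin

text \<open>The derivation clause of \<open>dp_family\<close>, read as a commutation rule with
  x_j^q, the intended image of x_j.\<close>

lemma Rep_z_X: "Rep_dn (z a) (sgl (sgl j q) 1 * f) = sgl (sgl j q) 1 * Rep_dn (z a) f +
    (if lkp a j = 0 then 0 else Rep_dn (z (a - sgl j 1)) f)"
proof -
  have "der j (z a) = (if lkp a j = 0 then 0 else z (a - sgl j 1))"
    using z by (simp add: dp_family_def)
  then show ?thesis using Rep_der[of j "z a" f] by (auto simp: Rep_dn_zero algebra_simps split: if_splits)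
qed

lemma Rep_z_mult: "Rep_dn (z a) (Rep_dn (z b) f) = of_nat (mchoose (a + b) a) * Rep_dn (z (a + b)) f"
proof -
  have "Rep_dn (of_nat n * x) f = of_nat n * Rep_dn x f" for n and x :: "('n, 'a) dn"
    using Rep_dn_const_mult[of "of_nat n" x] by (simp add: dn_const_of_nat smulop_def)
  moreover have "z a * z b = of_nat (mchoose (a + b) a) * z (a + b)"
    using z by (simp add: dp_family_def)
  ultimately show ?thesis by (metis Rep_dn_times comp_apply)
qed

lemma rmult_const: "rmult z (mulop (sgl 0 c))"
proof (rule rmultI)
  fix b :: "('n, 'a) pol" and a :: "'n \<Rightarrow>\<^sub>0 nat"
  have "mulop b \<circ> dpa a \<circ> mulop (sgl 0 c) = mulop (b * sgl 0 c) \<circ> dpa a"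
    by (auto simp: mulop_def dpa_const_mult mult.assoc)
  moreover have "mulop ((b * sgl 0 c) ^ q) \<circ> Rep_dn (z a) = mulop (b ^ q) \<circ> Rep_dn (z a) \<circ> mulop (sgl 0 c ^ q)"
    by (auto simp: mulop_def power_mult_distrib const_power_q Dn_const_mult mult.assoc)
  ultimately show "mulop b \<circ> dpa a \<circ> mulop (sgl 0 c) \<in> DP \<and>
     frobG z (mulop b \<circ> dpa a \<circ> mulop (sgl 0 c)) = mulop (b ^ q) \<circ> Rep_dn (z a) \<circ> frobG z (mulop (sgl 0 c))"
    by (simp add: mulop_dpa_in_DP frobG_single frobG_mulop[OF z])
qed (rule mulop_in_DP)

lemma rmult_X: "rmult z (mulop (sgl (sgl j 1) 1))"
proof (rule rmultI)
  fix b :: "('n, 'a) pol" and a :: "'n \<Rightarrow>\<^sub>0 nat"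
  let ?X = "sgl (sgl j 1) 1 :: ('n, 'a) pol"
  \<comment> \<open>For \<open>lkp a j = 0\<close> truncated subtraction would give \<open>a\<close>
    itself instead of no term; the zero coefficient removes it.\<close>
  let ?b = "if lkp a j = 0 then 0 else b"
  have 1: "mulop b \<circ> dpa a \<circ> mulop ?X = opadd (mulop (b * ?X) \<circ> dpa a) (mulop ?b \<circ> dpa (a - sgl j 1))"
    by (auto simp: mulop_def dpa_X_mult[OF additive_exponent_1, simplified] opadd_def fun_eq_iff distrib_left mult.assoc)
  have 2: "opadd (mulop ((b * ?X) ^ q) \<circ> Rep_dn (z a)) (mulop (?b ^ q) \<circ> Rep_dn (z (a - sgl j 1))) =
      mulop (b ^ q) \<circ> Rep_dn (z a) \<circ> mulop (?X ^ q)"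
    by (auto simp: fun_eq_iff mulop_def power_mult_distrib X_power_q[simplified] Rep_z_X[simplified]
        opadd_def zero_power[OF q_pos] distrib_left mult.assoc)
  show "mulop b \<circ> dpa a \<circ> mulop ?X \<in> DP \<and>
     frobG z (mulop b \<circ> dpa a \<circ> mulop ?X) = mulop (b ^ q) \<circ> Rep_dn (z a) \<circ> frobG z (mulop ?X)"
    unfolding 1 frobG_add[OF mulop_dpa_in_DP mulop_dpa_in_DP] frobG_single frobG_mulop[OF z] 2
    by (simp add: opadd_in_DP mulop_dpa_in_DP)
qed (rule mulop_in_DP)

lemma rmult_dpa: "rmult z (dpa a')"
proof (rule rmultI)
  fix b :: "('n, 'a) pol" and a :: "'n \<Rightarrow>\<^sub>0 nat"
  let ?n = "of_nat (mchoose (a + a') a) :: ('n, 'a) pol"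
  have 1: "mulop b \<circ> dpa a \<circ> dpa a' = mulop (b * ?n) \<circ> dpa (a + a')"
    by (auto simp: mulop_def dpa_dpa mult.assoc)
  \<comment> \<open>The structure constants are integers, hence fixed by the q-th power map.\<close>
  have 2: "mulop ((b * ?n) ^ q) \<circ> Rep_dn (z (a + a')) = mulop (b ^ q) \<circ> Rep_dn (z a) \<circ> Rep_dn (z a')"
    by (auto simp: mulop_def power_mult_distrib pol_of_nat_power_q Rep_z_mult mult.assoc)
  show "mulop b \<circ> dpa a \<circ> dpa a' \<in> DP \<and>
     frobG z (mulop b \<circ> dpa a \<circ> dpa a') = mulop (b ^ q) \<circ> Rep_dn (z a) \<circ> frobG z (dpa a')"
    unfolding 1 frobG_single frobG_dpa 2 by (simp add: mulop_dpa_in_DP)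
qed (rule dpa_in_DP)

text \<open>Peel off one variable at a time, by induction on the total degree.\<close>

lemma rmult_monomial: "rmult z (mulop (sgl m c))"
proof (induction "\<Sum>i\<in>UNIV. lkp m i" arbitrary: m rule: less_induct)
  case less
  show ?case
  proof (cases "m = 0")
    case True
    then show ?thesis by (simp add: rmult_const)
  next
    case False
    then obtain j where j: "lkp m j > 0" by (metis gr0I poly_mapping_eqI lookup_zero)
    define m' where "m' = m - sgl j 1"
    have m: "m = sgl j 1 + m'"
      using j by (intro poly_mapping_eqI) (auto simp: m'_def lookup_add lookup_minus lookup_single when_def)
    have "(\<Sum>i\<in>UNIV. lkp m' i) < (\<Sum>i\<in>UNIV. lkp m i)"
      using j by (intro sum_strict_mono_ex1) (auto simp: m'_def lookup_minus intro!: exI[of _ j])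
    then have "rmult z (mulop (sgl (sgl j 1) 1) \<circ> mulop (sgl m' c))"
      using less by (intro rmult_comp rmult_X) auto
    also have "mulop (sgl (sgl j 1) 1) \<circ> mulop (sgl m' c) = mulop (sgl m c)"
      by (simp add: m mult_single flip: mulop_mult)
    finally show ?thesis .
  qed
qed

lemma rmult_mulop: "rmult z (mulop b)"
  by (induction b rule: poly_mapping_additive_induct) (auto simp: mulop_add rmult_add rmult_monomial)

lemma rmult_DP: assumes "S \<in> DP" shows "rmult z S"
  using assms
proof (induction rule: DP_induct)
  case (single a b)
  have "rmult z (mulop b \<circ> dpa a)" by (intro rmult_comp rmult_mulop rmult_dpa)
  then show ?case by (simp only: dopP_single)
qed (rule rmult_add)

lemma ring_endo_frobG: "ring_endo (frobG z)"
  unfolding ring_endo_def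
proof (intro conjI ballI)
  show "frobG z \<in> extensional DP" by (simp add: frobG_def)
  show "frobG z id = id" using z by (simp add: frobG_dpa dp_family_def Rep_dn_one flip: dpa_0_eq_id)
next
  fix T :: "('n, 'a) op" assume "T \<in> DP"
  then show "frobG z T \<in> DP"
  proof (induction rule: DP_induct)
    case (single a b)
    have "Rep_dn (z a) \<in> DP" by (rule Dn_subset_DP) simp
    \<comment> \<open>Closure of \<open>DP\<close> under composition is part of
      \<open>rmult\<close>.\<close>
    then have "mulop (b ^ q) \<circ> Rep_dn (z a) \<in> DP" using rmult_DP mulop_in_DP by (auto simp: rmult_def)
    then show ?case by (simp only: dopP_single frobG_single)
  qed (simp add: frobG_add opadd_in_DP)
next
  fix S T :: "('n, 'a) op" assume "S \<in> DP" "T \<in> DP"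
  then show "frobG z (opadd S T) = opadd (frobG z S) (frobG z T)" "frobG z (S \<circ> T) = frobG z S \<circ> frobG z T"
    using rmult_DP by (auto simp: frobG_add rmult_def)
qed

end

section \<open>Existence and uniqueness of G_u\<close>

lemma ring_endo_unique:
  fixes G G' :: "('n, 'a) op \<Rightarrow> ('n, 'a) op"
  assumes "ring_endo G" "ring_endo G'" "\<And>b. G (mulop b) = G' (mulop b)" "\<And>a. G (dpa a) = G' (dpa a)"
  shows "G = G'"
proof (rule extensionalityI)
  show "G \<in> extensional DP" "G' \<in> extensional DP" using assms by (auto simp: ring_endo_def)
  fix T :: "('n, 'a) op" assume "T \<in> DP"
  then show "G T = G' T"
  proof (induction rule: DP_induct)
    case (single a b)
    have "G (mulop b \<circ> dpa a) = G' (mulop b \<circ> dpa a)"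
      using assms by (simp add: ring_endo_def mulop_in_DP dpa_in_DP)
    then show ?case by (simp only: dopP_single)
  next
    case (add S T)
    then show ?case using assms by (simp add: ring_endo_def)
  qed
qed

lemma Gu_prop_unique: "Gu_prop p s u G \<Longrightarrow> Gu_prop p s u G' \<Longrightarrow> G = G'"
  for u :: "'n \<Rightarrow> nat \<Rightarrow> ('n, 'a) op"
  using ring_endo_unique[of G G'] by (simp add: Gu_prop_def)

lemma Gu_prop_frobG:
  assumes "u \<in> Mset p s" shows "Gu_prop p s u (frobG (yprod (ydn u)))"
proof -
  have D: "\<And>i k. u i k \<in> Dn" using assms by (simp add: Mset_iff)
  show ?thesis using dp_family_yprod[OF assms]
    by (simp add: Gu_prop_def ring_endo_frobG frobG_mulop frobG_dpa yalpha_eq[OF D])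
qed

lemma Gu_eqI: "Gu_prop p s u G \<Longrightarrow> Gu p s u = G" for u :: "'n \<Rightarrow> nat \<Rightarrow> ('n, 'a) op"
  unfolding Gu_def using Gu_prop_unique by blast

end

subsection \<open>Endomorphisms in \<open>Frob\<close> and their matrices\<close>

lemma mchoose_single: "mchoose (sgl i a) (sgl i b) = a choose b"
proof -
  have "(\<Prod>j\<in>UNIV - {i}. lkp (sgl i a) j choose lkp (sgl i b) j) = 1"
    by (rule prod.neutral) (auto simp: lookup_single when_def)
  then show ?thesis by (simp add: mchoose_remove[of _ _ i])
qed

lemma dn_basis_single_mult:
  "dn_basis (sgl i a) * dn_basis (sgl i b) = of_nat ((a + b) choose a) * dn_basis (sgl i (a + b))"
  by (simp add: dn_basis_mult mchoose_single flip: single_add)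

text \<open>Structure constants of factors in disjoint sets of variables are 1.\<close>

lemma dn_basis_prod: "(dn_basis a :: ('n::finite, 'a::field) dn) = (\<Prod>i\<in>UNIV. dn_basis (sgl i (lkp a i)))"
proof -
  have "(\<Prod>i\<in>A. dn_basis (sgl i (lkp a i)) :: ('n, 'a) dn) = dn_basis (\<Sum>i\<in>A. sgl i (lkp a i))" if "finite A" for A
    using that
  proof (induction A rule: finite_induct)
    case (insert i A)
    let ?b = "\<Sum>i\<in>A. sgl i (lkp a i)"
    have "lkp ?b i = 0" using insert by (auto simp: lookup_sum lookup_single when_def)
    then have "mchoose (sgl i (lkp a i) + ?b) (sgl i (lkp a i)) = 1"
      unfolding mchoose_def by (intro prod.neutral) (auto simp: lookup_add lookup_single when_def)
    then show ?case using insert by (simp add: dn_basis_mult)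
  qed simp
  moreover have "(\<Sum>i\<in>UNIV. sgl i (lkp a i)) = a"
    by (rule poly_mapping_eqI) (simp add: lookup_sum lookup_single when_def)
  ultimately show ?thesis by simp
qed

context frob_setup
begin

text \<open>The factor added to reach exponent n + 1 brings the structure constant
  \<open>(Suc n * p ^ t) choose p ^ t\<close>, which is n + 1 modulo p.\<close>

lemma dn_basis_p_power_power: "(dn_basis (sgl i (p ^ t)) :: ('n, 'a) dn) ^ n = of_nat (fact n) * dn_basis (sgl i (n * p ^ t))"
proof (induction n)
  case (Suc n)
  have "(of_nat ((p ^ t + n * p ^ t) choose p ^ t) :: ('n, 'a) dn) = of_nat (Suc n)"
    using arg_cong[OF choose_mult_self[OF additive_q[of t], of "Suc n"], of dn_const] p_pos
    by (simp add: dn_const_of_nat mult.commute del: of_nat_Suc)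
  then have "dn_basis (sgl i (p ^ t)) * dn_basis (sgl i (n * p ^ t)) = of_nat (Suc n) * (dn_basis (sgl i (Suc n * p ^ t)) :: ('n, 'a) dn)"
    by (simp only: dn_basis_single_mult mult_Suc)
  moreover have "(dn_basis (sgl i (p ^ t)) :: ('n, 'a) dn) ^ Suc n = of_nat (fact n) * (dn_basis (sgl i (p ^ t)) * dn_basis (sgl i (n * p ^ t)))"
    by (simp only: power_Suc Suc mult_ac)
  moreover have "(of_nat (fact (Suc n)) :: ('n, 'a) dn) = of_nat (fact n) * of_nat (Suc n)"
    by (simp only: fact_Suc of_nat_mult mult.commute of_nat_id)
  ultimately show ?case by (simp only: mult.assoc)
qed simp

lemma divpow_dn_basis: "n < p \<Longrightarrow> divpow (dn_basis (sgl i (p ^ t)) :: ('n, 'a) dn) n = dn_basis (sgl i (n * p ^ t))"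
  by (rule divpow_unique[symmetric]) (simp_all only: dn_basis_p_power_power)

text \<open>Induct with \<open>t\<close> arbitrary: dropping the lowest digit of \<open>m\<close>
  raises \<open>t\<close> by one.\<close>

lemma digpow_dn_basis:
  "m < p ^ N \<Longrightarrow> digpow (\<lambda>k. dn_basis (sgl i (p ^ (k + t)))) N m = dn_basis (sgl i (m * p ^ t))"
proof (induction N arbitrary: t m)
  case (Suc N)
  define m0 m1 where m01: "m0 = m mod p" "m1 = m div p"
  have m: "m = p * m1 + m0" and lt: "m0 < p" using m01 p_pos by auto
  have "m1 < p ^ N" using Suc.prems m01 by (simp add: less_mult_imp_div_less mult.commute)
  then have IH: "digpow (\<lambda>k. dn_basis (sgl i (p ^ (Suc k + t)))) N m1 = dn_basis (sgl i (m1 * p ^ Suc t))"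
    using Suc.IH[of m1 "Suc t"] by (simp only: add_Suc_shift)
  have "m0 * p ^ t < p ^ Suc t" using lt p_pos by simp
  \<comment> \<open>Lucas in base p^(t+1), where \<open>m0 * p ^ t\<close> is a single digit, the
    lowest one of the upper entry; so the pieces multiply with factor 1.\<close>
  then have "(of_nat ((p ^ Suc t * m1 + m0 * p ^ t) choose (p ^ Suc t * 0 + m0 * p ^ t)) :: 'a) =
      of_nat (m1 choose 0) * of_nat ((m0 * p ^ t) choose (m0 * p ^ t))"
    by (intro choose_lucas additive_q)
  then have luc: "(of_nat ((m0 * p ^ t + m1 * p ^ Suc t) choose (m0 * p ^ t)) :: 'a) = 1"
    by (simp add: algebra_simps)
  have luc: "(of_nat ((m0 * p ^ t + m1 * p ^ Suc t) choose (m0 * p ^ t)) :: ('n, 'a) dn) = 1"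
    by (metis luc dn_const_of_nat dn_const_1)
  have "digpow (\<lambda>k. dn_basis (sgl i (p ^ (k + t)))) (Suc N) m = dn_basis (sgl i (m0 * p ^ t)) * dn_basis (sgl i (m1 * p ^ Suc t))"
    using IH divpow_dn_basis[OF lt, of i t] by (simp only: digpow_Suc m01 add_0)
  also have "\<dots> = dn_basis (sgl i (m0 * p ^ t + m1 * p ^ Suc t))"
    by (simp only: dn_basis_single_mult luc mult_1)
  also have "m0 * p ^ t + m1 * p ^ Suc t = m * p ^ t"
    by (simp add: m algebra_simps)
  finally show ?case .
qed simp

text \<open>Hence the values of a ring endomorphism at the divided powers of index p^k determine it
  on the whole basis.\<close>

lemma dn_basis_eq_divpows: "dn_basis (sgl i m) = divpows (\<lambda>k. dn_basis (sgl i (p ^ k))) m"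
  using digpow_dn_basis[OF less_p_power, where t = 0] by (simp add: divpows_def)

section \<open>Each G_u lies in \<open>Frob\<close> and determines u\<close>

lemma ring_endo_Dn:
  fixes G :: "('n, 'a) op \<Rightarrow> ('n, 'a) op"
  assumes "ring_endo G" "\<And>a. G (mulop a) = mulop (a ^ q)" "\<And>a. G (dpa a) \<in> Dn" "T \<in> Dn"
  shows "G T \<in> Dn"
  using assms(4)
proof (induction rule: Dn_induct)
  case (single a c)
  have "smulop c (dpa a) = mulop (sgl 0 c) \<circ> dpa a" by (auto simp: smulop_def mulop_def)
  then have "G (smulop c (dpa a)) = mulop (sgl 0 c ^ q) \<circ> G (dpa a)"
    using assms(1,2) by (simp add: ring_endo_def mulop_in_DP dpa_in_DP)
  also have "\<dots> = smulop (c ^ q) (G (dpa a))"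
    by (auto simp: const_power_q smulop_def mulop_def)
  finally show ?case using smulop_in_Dn[OF assms(3)] by simp
next
  case (add S T)
  then show ?case using assms(1) by (simp add: ring_endo_def Dn_subset_DP opadd_in_Dn)
qed

lemma Gu_prop_in_Frob:
  fixes u :: "'n \<Rightarrow> nat \<Rightarrow> ('n, 'a) op"
  assumes "u \<in> Mset p s" "Gu_prop p s u G" shows "G \<in> Frob p s"
proof -
  have D: "\<And>i k. u i k \<in> Dn" using assms by (simp add: Mset_iff)
  show ?thesis using assms(2) ring_endo_Dn[of G]
    by (simp add: Frob_def Gu_prop_def yalpha_eq[OF D])
qed

text \<open>Solve the recursion \<open>ydn_eq\<close> for the entry of \<open>u\<close>.\<close>

lemma uG_Gu_prop:
  fixes u :: "'n \<Rightarrow> nat \<Rightarrow> ('n, 'a) op"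
  assumes "u \<in> Mset p s" "Gu_prop p s u G" shows "uG p s G = u"
proof (intro ext)
  fix i k f
  have D: "\<And>i k. u i k \<in> Dn" using assms by (simp add: Mset_iff)
  have "G (dpi i m) = Rep_dn (divpows (ydn u i) m)" for m
    using assms(2) by (simp add: Gu_prop_def dpi_def yalpha_eq[OF D] yprod_single)
  then have "uG p s G i k = Rep_dn (ydn u i k - shift i (divpows (ydn u i) (p ^ k - 1)))"
    by (simp add: uG_def divpows_p_power Rep_dn_minus Rep_shift)
  also have "ydn u i k - shift i (divpows (ydn u i) (p ^ k - 1)) = Abs_dn (u i k)"
    by (subst ydn_eq[OF D]) simp
  finally show "uG p s G i k f = u i k f" by (simp add: Abs_dn_inverse D)
qed

section \<open>From an element of \<open>Frob\<close> to its matrix\<close>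

context
  fixes G :: "('n, 'a) op \<Rightarrow> ('n, 'a) op"
  assumes G: "G \<in> Frob p s"
begin

definition Gdn :: "('n, 'a) dn \<Rightarrow> ('n, 'a) dn"
  where "Gdn x = Abs_dn (G (Rep_dn x))"

lemma Rep_Gdn: "Rep_dn (Gdn x) = G (Rep_dn x)"
  using G by (simp add: Gdn_def Abs_dn_inverse Frob_def)

lemma G_add: "S \<in> DP \<Longrightarrow> T \<in> DP \<Longrightarrow> G (opadd S T) = opadd (G S) (G T)"
  and G_comp: "S \<in> DP \<Longrightarrow> T \<in> DP \<Longrightarrow> G (S \<circ> T) = G S \<circ> G T"
  and G_id: "G id = id" and G_mulop: "G (mulop b) = mulop (b ^ q)"
  using G by (simp_all add: Frob_def ring_endo_def)

lemma Rep_in_DP: "Rep_dn x \<in> DP"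
  by (simp add: Dn_subset_DP)

lemma G_zero: "G (\<lambda>f. 0) = (\<lambda>f. 0)"
  using G_mulop[of 0] by (simp add: mulop_def zero_power[OF q_pos])

lemma Gdn_0: "Gdn 0 = 0" and Gdn_1: "Gdn 1 = 1"
  and Gdn_add: "Gdn (x + y) = Gdn x + Gdn y"
  and Gdn_mult: "Gdn (x * y) = Gdn x * Gdn y"
  by (rule dn_eqI, simp add: Rep_Gdn Rep_dn_ring G_zero G_id G_add G_comp Rep_in_DP)+

lemma Gdn_of_nat: "Gdn (of_nat n) = of_nat n"
  by (induction n) (simp_all add: Gdn_0 Gdn_1 Gdn_add)

lemma Gdn_power: "Gdn (x ^ n) = Gdn x ^ n"
  by (induction n) (simp_all add: Gdn_1 Gdn_mult)

lemma Gdn_prod: "Gdn (\<Prod>i\<in>A. f i) = (\<Prod>i\<in>A. Gdn (f i))"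
  by (induction A rule: infinite_finite_induct) (simp_all add: Gdn_1 Gdn_mult)

lemma Gdn_divpow: "n < p \<Longrightarrow> Gdn (divpow x n) = divpow (Gdn x) n"
proof (rule divpow_unique)
  assume "n < p"
  have "of_nat (fact n) * Gdn (divpow x n) = Gdn (of_nat (fact n) * divpow x n)"
    by (simp only: Gdn_mult Gdn_of_nat)
  then show "of_nat (fact n) * Gdn (divpow x n) = Gdn x ^ n"
    by (simp only: fact_mult_divpow[OF \<open>n < p\<close>] Gdn_power)
qed

lemma Gdn_divpows: "Gdn (divpows Y m) = divpows (\<lambda>k. Gdn (Y k)) m"
  unfolding divpows_def digpow_def Gdn_prod using p_pos by (simp only: Gdn_divpow mod_less_divisor)

text \<open>Apply \<open>G\<close> to the Leibniz rule for \<open>dpa a\<close> and x_j. As x_j goes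
  to x_j^q, the commutator with x_j turns into \<open>der j\<close>.\<close>

lemma der_Gdn_dn_basis: "der j (Gdn (dn_basis a)) = (if lkp a j = 0 then 0 else Gdn (dn_basis (a - sgl j 1)))"
proof (rule dn_eqI)
  fix f
  let ?X = "sgl (sgl j 1) 1 :: ('n, 'a) pol"
  let ?R = "if lkp a j = 0 then (\<lambda>f. 0) else dpa (a - sgl j 1) :: ('n, 'a) op"
  have R: "?R \<in> DP" by (simp add: zero_in_DP dpa_in_DP)
  have XD: "mulop ?X \<circ> dpa a \<in> DP" by (rule mulop_dpa_in_DP)
  have "dpa a \<circ> mulop ?X = opadd (mulop ?X \<circ> dpa a) ?R"
    by (auto simp: mulop_def dpa_X_mult[OF additive_exponent_1, simplified] opadd_def)
  then have "G (dpa a) \<circ> mulop (?X ^ q) = opadd (mulop (?X ^ q) \<circ> G (dpa a)) (G ?R)"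
    by (metis G_add[OF XD R] G_comp dpa_in_DP mulop_in_DP G_mulop)
  then have "G (dpa a) (?X ^ q * f) = ?X ^ q * G (dpa a) f + G ?R f"
    by (simp add: fun_eq_iff mulop_def opadd_def)
  then have "Rep_dn (der j (Gdn (dn_basis a))) f = G ?R f"
    unfolding X_power_q by (simp add: Rep_der Rep_Gdn Rep_dn_basis)
  then show "Rep_dn (der j (Gdn (dn_basis a))) f = Rep_dn (if lkp a j = 0 then 0 else Gdn (dn_basis (a - sgl j 1))) f"
    by (simp add: Rep_Gdn Rep_dn_basis Rep_dn_zero G_zero split: if_splits)
qed

definition Gpow :: "'n \<Rightarrow> nat \<Rightarrow> ('n, 'a) dn"
  where "Gpow i k = Gdn (dn_basis (sgl i (p ^ k)))"

lemma Gdn_dn_basis_single: "Gdn (dn_basis (sgl i m)) = divpows (Gpow i) m"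
  by (subst dn_basis_eq_divpows) (simp add: Gdn_divpows flip: Gpow_def)

lemma Gdn_dn_basis: "Gdn (dn_basis a) = yprod Gpow a"
  by (subst dn_basis_prod) (simp add: Gdn_prod Gdn_dn_basis_single yprod_def)

lemma uG_eq: "uG p s G i k = Rep_dn (Gpow i k - shift i (divpows (Gpow i) (p ^ k - 1)))"
  unfolding uG_def Rep_dn_minus Rep_shift Gpow_def Gdn_dn_basis_single[symmetric] Rep_Gdn Rep_dn_basis dpi_def ..

text \<open>The constant term vanishes because \<open>G\<close> preserves the relation that
  nontrivial basis elements have p-th power 0. In direction i the section property cancels the two
  derivatives; in other directions both vanish.\<close>

lemma uG_in_Mset: "uG p s G \<in> Mset p s"
  unfolding Mset_iff uG_eq Rep_dn_inverse
proof (intro allI conjI)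
  fix i k
  show "Rep_dn (Gpow i k - shift i (divpows (Gpow i) (p ^ k - 1))) \<in> Dn" by simp
  have "sgl i (p ^ k) \<noteq> 0" using p_pos by (metis lookup_single_eq lookup_zero power_eq_0_iff not_less0)
  then have "(dn_basis (sgl i (p ^ k)) :: ('n, 'a) dn) ^ p = 0"
    by (rule dn_basis_power_CHAR[OF CHAR p_pos])
  then have "Gpow i k ^ p = 0"
    unfolding Gpow_def Gdn_power[symmetric] by (simp add: Gdn_0)
  then show "coef (Gpow i k - shift i (divpows (Gpow i) (p ^ k - 1))) 0 = 0"
    by (simp add: coef_minus coef_shift_0 coef_eq_0_if_power_p)
  fix j
  show "der j (Gpow i k - shift i (divpows (Gpow i) (p ^ k - 1))) = 0"
  proof (cases "i = j")
    case True
    have "sgl i (p ^ k) - sgl i 1 = sgl i (p ^ k - 1)" by (simp flip: single_diff)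
    then show ?thesis using True p_pos
      by (simp add: der_minus der_shift_same Gpow_def der_Gdn_dn_basis flip: Gdn_dn_basis_single)
  next
    case False
    then show ?thesis
      by (simp add: der_minus der_shift_other shift_0 Gpow_def der_Gdn_dn_basis lookup_single flip: Gdn_dn_basis_single)
  qed
qed

text \<open>\<open>Gpow\<close> obeys the recursion that defines \<open>ydn\<close> for this matrix;
  the induction is strong because the product involves all smaller indices.\<close>

lemma ydn_uG: "ydn (uG p s G) i k = Gpow i k"
proof (induction k rule: less_induct)
  case (less k)
  have "uG p s G i k \<in> Dn" for i k using uG_in_Mset by (simp add: Mset_iff)
  from conjunct2[OF ypq_eq[OF this]]
  have "ydn (uG p s G) i k = Abs_dn (uG p s G i k) + shift i (\<Prod>l<k. divpow (ydn (uG p s G) i l) (p - 1))" .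
  also have "(\<Prod>l<k. divpow (ydn (uG p s G) i l) (p - 1)) = divpows (Gpow i) (p ^ k - 1)"
    unfolding divpows_p_power_minus_1 by (rule prod.cong) (simp_all add: less)
  finally show ?case by (simp add: uG_eq Rep_dn_inverse)
qed

lemma Gu_prop_uG: "Gu_prop p s (uG p s G) G"
proof -
  have D: "uG p s G i k \<in> Dn" for i k using uG_in_Mset by (simp add: Mset_iff)
  have "ydn (uG p s G) = Gpow" by (intro ext) (rule ydn_uG)
  then have "G (dpa a) = yalpha p s (uG p s G) a" for a
    by (simp add: yalpha_eq[OF D] Rep_Gdn Rep_dn_basis flip: Gdn_dn_basis)
  then show ?thesis using G by (simp add: Gu_prop_def Frob_def)
qed

end

end

theorem theorem5p2:
  fixes p s :: nat
  assumes "CHAR('a::field) = p" and "p > 0" and "s \<ge> 1"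
  shows "(\<forall>u \<in> (Mset p s :: ('n::finite \<Rightarrow> nat \<Rightarrow> ('n, 'a) op) set). \<exists>!G. Gu_prop p s u G)
       \<and> bij_betw (Gu p s) (Mset p s :: ('n::finite \<Rightarrow> nat \<Rightarrow> ('n, 'a) op) set) (Frob p s)
       \<and> (\<forall>G \<in> (Frob p s :: (('n, 'a) op \<Rightarrow> ('n, 'a) op) set). uG p s G \<in> Mset p s \<and> Gu p s (uG p s G) = G)
       \<and> (\<forall>u \<in> (Mset p s :: ('n::finite \<Rightarrow> nat \<Rightarrow> ('n, 'a) op) set). uG p s (Gu p s u) = u)"
proof -
  \<comment> \<open>A positive characteristic of a field is prime.\<close>
  interpret frob_setup "TYPE('n \<times> 'a)" p s
    using assms prime_CHAR_semidom[where ?'a = 'a] by unfold_locales auto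
  have ex: "Gu_prop p s u (Gu p s u)" if "u \<in> Mset p s" for u :: "'n \<Rightarrow> nat \<Rightarrow> ('n, 'a) op"
    using Gu_prop_frobG[OF that] Gu_eqI by metis
  have 1: "\<exists>!G. Gu_prop p s u G" if "u \<in> Mset p s" for u :: "'n \<Rightarrow> nat \<Rightarrow> ('n, 'a) op"
    using ex[OF that] Gu_prop_unique by blast
  have 2: "uG p s G \<in> Mset p s" "Gu p s (uG p s G) = G"
    if "G \<in> Frob p s" for G :: "('n, 'a) op \<Rightarrow> ('n, 'a) op"
    using that by (auto intro: uG_in_Mset Gu_eqI Gu_prop_uG)
  have 3: "uG p s (Gu p s u) = u" if "u \<in> Mset p s" for u :: "'n \<Rightarrow> nat \<Rightarrow> ('n, 'a) op"
    using uG_Gu_prop[OF that ex[OF that]] .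
  have 4: "Gu p s u \<in> Frob p s" if "u \<in> Mset p s" for u :: "'n \<Rightarrow> nat \<Rightarrow> ('n, 'a) op"
    using Gu_prop_in_Frob[OF that ex[OF that]] .
  have "bij_betw (Gu p s) (Mset p s :: ('n \<Rightarrow> nat \<Rightarrow> ('n, 'a) op) set) (Frob p s)"
    by (rule bij_betw_byWitness[where f' = "uG p s"]) (use 2 3 4 in auto)
  with 1 2 3 show ?thesis by blast
qed

end
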